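(* Let $X_1,X_2,\dots$ be random variables in a separable Hilbert space $H$ such that, for some $\mu\in H$ and constant $\sigma^2$, $\|X_t\|\in[0,\frac12]$, $\mathbb{E}_{t-1}X_t=\mu$ and $\mathbb{E}_{t-1}\|X_t-\mu\|^2=\sigma^2$ for all $t\ge1$. Let $\alpha\in(0,1)$ and $\alpha_1,\alpha_2>0$ with $\alpha_1+\alpha_2=\alpha$. Let $(\widehat\sigma_i^2)_{i\ge1}$ be any $[0,1]$-valued predictable sequence, $(\lambda_i)_{i\ge1}$ any $[0,1)$-valued predictable sequence and $(\tilde\lambda_i)_{i\ge1}$ any $[0,\infty)$-valued predictable sequence, and let $\widehat\mu_1^{\mathrm{HS}}=0$ and $\widehat\mu_t^{\mathrm{HS}}=\frac{\sum_{i=1}^{t-1}\tilde\lambda_iX_i}{\sum_{i=1}^{t-1}\tilde\lambda_i}$ for $t\ge2$. Then the sequence of intervals $(L_t^{\mathrm{HS}},\infty)$, $t\ge1$, is a $1-\alpha$ (lower) confidence sequence for $\sigma^2$, where $$L_t^{\mathrm{HS}}=\frac{-B_{t,\alpha_1}+\sqrt{B_{t,\alpha_1}^2+4A_t\left(D_t^{\mathrm{HS}}-C_{t,\alpha_1}-R_{t,\alpha_2}^{\mathrm{HS}}\right)}}{2A_t},$$ and $A_t,B_{t,\alpha_1},C_{t,\alpha_1},D_t^{\mathrm{HS}},R_{t,\alpha_2}^{\mathrm{HS}}$ are defined in the context.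
   Context: All random variables live on a common probability space with probability $\mathbb{P}$. $\mathcal{F}_t=\sigma(X_1,\dots,X_t)$ is the canonical filtration, with $\mathcal{F}_0$ trivial; $\mathbb{E}_t[\cdot]=\mathbb{E}[\cdot\mid\mathcal{F}_t]$ (in the Bochner sense for $H$-valued variables). Relations between random variables hold almost surely. A sequence $(M_i)_{i\ge1}$ is predictable if $M_i$ is $\mathcal{F}_{i-1}$-measurable for all $i\ge1$. A sequence of random sets $(C_t)_{t\ge1}$ is a $1-\alpha$ confidence sequence for $\theta$ if $\mathbb{P}(\forall t\ge1:\theta\in C_t)\ge1-\alpha$. $\psi_E(\lambda)=-\log(1-\lambda)-\lambda$ for $\lambda\in[0,1)$ and $\psi_P(\lambda)=\exp(\lambda)-\lambda-1$ for $\lambda\ge0$. Define $$D_t^{\mathrm{HS}}=\frac{\sum_{i\le t}\lambda_i\|X_i-\widehat\mu_i^{\mathrm{HS}}\|^2}{\sum_{i\le t}\lambda_i},\quad R_{t,\delta}^{\mathrm{HS}}=\frac{\log(1/\delta)+\sum_{i\le t}\psi_E(\lambda_i)\left(\|X_i-\widehat\mu_i^{\mathrm{HS}}\|^2-\widehat\sigma_i^2\right)^2}{\sum_{i\le t}\lambda_i}.$$ For $t\ge2$, $$\tilde A_t=\frac{\left(\sum_{i=1}^{t-1}\psi_P(\tilde\lambda_i)\right)^2}{\left(\sum_{i=1}^{t-1}\tilde\lambda_i\right)^2},\quad \tilde B_{t,\delta}=\frac{2\log(2/\delta)\sum_{i=1}^{t-1}\psi_P(\tilde\lambda_i)}{\left(\sum_{i=1}^{t-1}\tilde\lambda_i\right)^2},\quad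 \tilde C_{t,\delta}=\frac{\log^2(2/\delta)}{\left(\sum_{i=1}^{t-1}\tilde\lambda_i\right)^2},$$ and $\tilde A_1=\tilde B_{1,\delta}=0$, $\tilde C_{1,\delta}=\frac14$. Then $$A_t=\frac{\sum_{i\le t}\lambda_i\tilde A_i}{\sum_{i\le t}\lambda_i},\quad B_{t,\delta}=1+\frac{\sum_{i\le t}\lambda_i\tilde B_{i,\delta}}{\sum_{i\le t}\lambda_i},\quad C_{t,\delta}=\frac{\sum_{i\le t}\lambda_i\tilde C_{i,\delta}}{\sum_{i\le t}\lambda_i}.$$ Conventions for degenerate cases: if $\sum_{i=1}^{t-1}\tilde\lambda_i=0$ for some $t\ge2$, then $\widehat\mu_t^{\mathrm{HS}},\tilde A_t,\tilde B_{t,\delta},\tilde C_{t,\delta}$ take their $t=1$ values. If the expression for $L_t^{\mathrm{HS}}$ is not a well-defined real number (i.e. $\sum_{i\le t}\lambda_i=0$, or $A_t=0$, or the quantity under the square root is negative), then $L_t^{\mathrm{HS}}=-\infty$. *)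

theory Defs
  imports "HOL-Probability.Probability"
begin

text \<open>Random sequences are indexed by the positive integers; values at index 0 are never used.\<close>

definition canonical_filtration ::
    "'w measure \<Rightarrow> (nat \<Rightarrow> 'w \<Rightarrow> 'h::topological_space) \<Rightarrow> nat \<Rightarrow> 'w measure" where
  "canonical_filtration M X t =
     sigma (space M) {X i -` A \<inter> space M | i A. i \<in> {1..t} \<and> A \<in> sets borel}"

definition predictable :: "(nat \<Rightarrow> 'w measure) \<Rightarrow> (nat \<Rightarrow> 'w \<Rightarrow> real) \<Rightarrow> bool" where
  "predictable F m \<longleftrightarrow> (\<forall>i\<ge>1. m i \<in> borel_measurable (F (i - 1)))"

text \<open>
  The library has conditional expectations only for real-valued functions
  (\<^const>\<open>real_cond_exp\<close>). The predicate below says that g is a version of the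
  Bochner conditional expectation of the vector-valued f given F; such a g is
  unique up to almost sure equality.
\<close>

definition has_cond_exp ::
    "'w measure \<Rightarrow> 'w measure \<Rightarrow> ('w \<Rightarrow> 'h::{banach, second_countable_topology}) \<Rightarrow> ('w \<Rightarrow> 'h) \<Rightarrow> bool" where
  "has_cond_exp M F f g \<longleftrightarrow>
     integrable M f \<and> integrable M g \<and> g \<in> borel_measurable F \<and>
     (\<forall>A\<in>sets F. set_lebesgue_integral M A f = set_lebesgue_integral M A g)"

definition confidence_sequence ::
    "'w measure \<Rightarrow> real \<Rightarrow> 'b \<Rightarrow> (nat \<Rightarrow> 'w \<Rightarrow> 'b set) \<Rightarrow> bool" where
  "confidence_sequence M p \<theta> C \<longleftrightarrow> measure M {\<omega> \<in> space M. \<forall>t\<ge>1. \<theta> \<in> C t \<omega>} \<ge> p"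

definition psiE :: "real \<Rightarrow> real" where
  "psiE l = - ln (1 - l) - l"

definition psiP :: "real \<Rightarrow> real" where
  "psiP l = exp l - l - 1"

text \<open>
  The quantities below are defined pathwise: their arguments are the realised sequences
  x of observations, l and lt of weights (for \<open>\<lambda>\<close> and \<open>\<lambda>\<close> with a tilde), and s2 of
  variance estimates. The test for a vanishing sum covers both the case t = 1 (empty sum)
  and the degenerate case t \<open>\<ge>\<close> 2, in which the value for t = 1 is used.
\<close>

definition mu_hs :: "(nat \<Rightarrow> real) \<Rightarrow> (nat \<Rightarrow> 'h::real_vector) \<Rightarrow> nat \<Rightarrow> 'h" where
  "mu_hs lt x t =
     (if (\<Sum>i=1..<t. lt i) = 0 then 0
      else (\<Sum>i=1..<t. lt i *\<^sub>R x i) /\<^sub>R (\<Sum>i=1..<t. lt i))"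

definition At_tilde :: "(nat \<Rightarrow> real) \<Rightarrow> nat \<Rightarrow> real" where
  "At_tilde lt t =
     (if (\<Sum>i=1..<t. lt i) = 0 then 0
      else (\<Sum>i=1..<t. psiP (lt i))\<^sup>2 / (\<Sum>i=1..<t. lt i)\<^sup>2)"

definition Bt_tilde :: "real \<Rightarrow> (nat \<Rightarrow> real) \<Rightarrow> nat \<Rightarrow> real" where
  "Bt_tilde \<delta> lt t =
     (if (\<Sum>i=1..<t. lt i) = 0 then 0
      else 2 * ln (2 / \<delta>) * (\<Sum>i=1..<t. psiP (lt i)) / (\<Sum>i=1..<t. lt i)\<^sup>2)"

definition Ct_tilde :: "real \<Rightarrow> (nat \<Rightarrow> real) \<Rightarrow> nat \<Rightarrow> real" where
  "Ct_tilde \<delta> lt t =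
     (if (\<Sum>i=1..<t. lt i) = 0 then 1 / 4
      else (ln (2 / \<delta>))\<^sup>2 / (\<Sum>i=1..<t. lt i)\<^sup>2)"

definition A_hs :: "(nat \<Rightarrow> real) \<Rightarrow> (nat \<Rightarrow> real) \<Rightarrow> nat \<Rightarrow> real" where
  "A_hs l lt t = (\<Sum>i=1..t. l i * At_tilde lt i) / (\<Sum>i=1..t. l i)"

definition B_hs :: "real \<Rightarrow> (nat \<Rightarrow> real) \<Rightarrow> (nat \<Rightarrow> real) \<Rightarrow> nat \<Rightarrow> real" where
  "B_hs \<delta> l lt t = 1 + (\<Sum>i=1..t. l i * Bt_tilde \<delta> lt i) / (\<Sum>i=1..t. l i)"

definition C_hs :: "real \<Rightarrow> (nat \<Rightarrow> real) \<Rightarrow> (nat \<Rightarrow> real) \<Rightarrow> nat \<Rightarrow> real" where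
  "C_hs \<delta> l lt t = (\<Sum>i=1..t. l i * Ct_tilde \<delta> lt i) / (\<Sum>i=1..t. l i)"

definition D_hs ::
    "(nat \<Rightarrow> real) \<Rightarrow> (nat \<Rightarrow> real) \<Rightarrow> (nat \<Rightarrow> 'h::real_normed_vector) \<Rightarrow> nat \<Rightarrow> real" where
  "D_hs l lt x t =
     (\<Sum>i=1..t. l i * (norm (x i - mu_hs lt x i))\<^sup>2) / (\<Sum>i=1..t. l i)"

definition R_hs ::
    "real \<Rightarrow> (nat \<Rightarrow> real) \<Rightarrow> (nat \<Rightarrow> real) \<Rightarrow> (nat \<Rightarrow> real) \<Rightarrow> (nat \<Rightarrow> 'h::real_normed_vector) \<Rightarrow> nat \<Rightarrow> real" where
  "R_hs \<delta> l lt s2 x t =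
     (ln (1 / \<delta>) + (\<Sum>i=1..t. psiE (l i) * ((norm (x i - mu_hs lt x i))\<^sup>2 - s2 i)\<^sup>2))
       / (\<Sum>i=1..t. l i)"

definition L_hs ::
    "real \<Rightarrow> real \<Rightarrow> (nat \<Rightarrow> real) \<Rightarrow> (nat \<Rightarrow> real) \<Rightarrow> (nat \<Rightarrow> real) \<Rightarrow> (nat \<Rightarrow> 'h::real_normed_vector)
      \<Rightarrow> nat \<Rightarrow> ereal" where
  "L_hs \<alpha>1 \<alpha>2 l lt s2 x t =
     (let A = A_hs l lt t;
          B = B_hs \<alpha>1 l lt t;
          Q = B\<^sup>2 + 4 * A * (D_hs l lt x t - C_hs \<alpha>1 l lt t - R_hs \<alpha>2 l lt s2 x t)
      in if (\<Sum>i=1..t. l i) = 0 \<or> A = 0 \<or> Q < 0 then - \<infinity>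
         else ereal ((- B + sqrt Q) / (2 * A)))"

end

theory Submission
  imports Defs
begin

text \<open>
  The lower confidence limit solves a quadratic inequality for the variance \<open>v = \<sigma>\<^sup>2\<close> that results from
  two deviation inequalities, each of which holds uniformly in time with high probability.

  The squared residual of an observation from a predictable centre m has conditional mean
  \<open>v + (norm (m - \<mu>))\<^sup>2\<close>. An empirical Bernstein inequality (\<open>empirical_bernstein_bound\<close>) bounds the weighted
  sum of the squared residuals by that of these means plus the penalty in \<open>R_hs\<close>, except on an event of
  probability \<open>\<alpha>2\<close>. The errors \<open>norm (m - \<mu>)\<close> are unknown, but the centres are weighted means
  of past observations; the inequality of Pinelis for martingales in Hilbert space
  (\<open>pinelis_bound\<close>) bounds them by \<open>(ln (2 / \<alpha>1) + v * (\<Sum>i. psiP (lt i))) / (\<Sum>i. lt i)\<close>, except on an event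
  of probability \<open>\<alpha>1\<close>. Squaring produces a quadratic polynomial in v, and the two bounds together say
  \<open>D - C - R < A * v\<^sup>2 + B * v\<close>. Hence v lies above the larger root (\<open>L_hs_less\<close>).

  Both deviation inequalities come from Ville's maximal inequality for nonnegative supermartingales
  (\<open>ville_inequality\<close>). In both cases the supermartingale property reduces to a pointwise bound of
  the next value by a quadratic expression \<open>P + V \<bullet> Z + Q * (norm Z)\<^sup>2\<close> in the centred observation Z, with
  coefficients known beforehand: the linear term has conditional mean 0, and the quadratic one has
  conditional mean \<open>Q * v\<close> (\<open>quadratic_conditional_bound\<close>). For the inequality of Pinelis the pointwise bound
  is \<open>cosh_norm_add_le\<close>, for the Bernstein inequality it is Fan's inequality \<open>exp_psiE_le\<close>.
\<close>

section \<open>Elementary inequalities\<close>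

lemma power_convex_combination:
  fixes p q w :: real
  assumes "0 \<le> p" "0 \<le> q" "0 \<le> w" "w \<le> 1"
  shows "((1 - w) * p + w * q) ^ k \<le> (1 - w) * p ^ k + w * q ^ k"
proof -
  have c: "convex_on {0::real..} (\<lambda>x. x ^ k)"
    by (cases "even k") (auto intro: convex_power_odd convex_on_subset[OF convex_power_even])
  show ?thesis
    using convex_onD[OF c, of w p q] assms by simp
qed

text \<open>
  The function \<open>r \<mapsto> cosh (sqrt r)\<close> is convex on the nonnegative reals, because its power series
  \<open>\<Sum>k. r ^ k / (2 k)!\<close> is a sum of convex functions with nonnegative coefficients.
\<close>

lemma cosh_convex_in_square:
  fixes r p q w :: real
  assumes w: "0 \<le> w" "w \<le> 1" and r: "r\<^sup>2 = (1 - w) * p\<^sup>2 + w * q\<^sup>2"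
  shows "cosh r \<le> (1 - w) * cosh p + w * cosh q"
proof (rule sums_le)
  show "(\<lambda>n. if even n then r ^ n /\<^sub>R fact n else 0) sums cosh r"
    by (rule cosh_converges)
  show "(\<lambda>n. (1 - w) * (if even n then p ^ n /\<^sub>R fact n else 0) + w * (if even n then q ^ n /\<^sub>R fact n else 0))
          sums ((1 - w) * cosh p + w * cosh q)"
    by (intro sums_add sums_mult cosh_converges)
  fix n
  have "r ^ (2 * k) \<le> (1 - w) * p ^ (2 * k) + w * q ^ (2 * k)" for k
    using power_convex_combination[of "p\<^sup>2" "q\<^sup>2" w k] w
    unfolding power_mult r by simp
  then have "r ^ n \<le> (1 - w) * p ^ n + w * q ^ n" if "even n"
    using that by (auto elim!: evenE)
  then have "r ^ n / fact n \<le> ((1 - w) * p ^ n + w * q ^ n) / fact n" if "even n"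
    using that by (intro divide_right_mono) auto
  then show "(if even n then r ^ n /\<^sub>R fact n else 0)
      \<le> (1 - w) * (if even n then p ^ n /\<^sub>R fact n else 0) + w * (if even n then q ^ n /\<^sub>R fact n else 0)"
    by (simp add: divide_inverse algebra_simps)
qed

lemma le_sinh:
  fixes x :: real
  assumes "0 \<le> x"
  shows "x \<le> sinh x"
proof -
  have "sinh 0 - 0 \<le> sinh x - x"
  proof (rule DERIV_nonneg_imp_nondecreasing[OF assms])
    fix y :: real
    show "\<exists>d. ((\<lambda>x. sinh x - x) has_real_derivative d) (at y) \<and> 0 \<le> d"
      by (rule exI[of _ "cosh y - 1"]) (auto intro!: derivative_eq_intros simp: cosh_real_ge_1)
  qed
  then show ?thesis by simp
qed

text \<open>
  The pointwise form of the inequality of Pinelis in Hilbert space. For vectors of fixed lengths a and b,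
  the square of \<open>norm (s + d)\<close> is affine in the cosine c of the angle between them, so by convexity
  \<open>cosh (norm (s + d))\<close> lies below its chord between \<open>c = -1\<close> and \<open>c = 1\<close>. The chord is
  \<open>cosh a * cosh b + c * sinh a * sinh b\<close>, and replacing \<open>sinh b\<close> by b in the second summand costs at most
  \<open>cosh a * (sinh b - b)\<close>. The bound is linear in d up to a term in the norm of d only, so the linear
  part disappears under a conditional expectation. For \<open>s = 0\<close> the quotient is \<open>0\<close> by the convention
  for division by zero, which agrees with the vanishing inner product.
\<close>

lemma cosh_norm_add_le:
  fixes s d :: "'a::real_inner"
  shows "cosh (norm (s + d))
    \<le> cosh (norm s) + (sinh (norm s) / norm s) * (s \<bullet> d) + cosh (norm s) * psiP (norm d)"
proof -
  define a b c where abc: "a = norm s" "b = norm d" "c = (s \<bullet> d) / (norm s * norm d)"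
  have a0: "0 \<le> a" and b0: "0 \<le> b" by (auto simp: abc)
  have sd: "s \<bullet> d = a * b * c"
    by (auto simp: abc)
  have c1: "\<bar>c\<bar> \<le> 1"
    using Cauchy_Schwarz_ineq2[of s d] by (auto simp: abc divide_le_eq_1 abs_mult)
  have "cosh (norm (s + d)) \<le> (1 - (1 + c) / 2) * cosh (a - b) + (1 + c) / 2 * cosh (a + b)"
  proof (rule cosh_convex_in_square)
    have "(norm (s + d))\<^sup>2 = a\<^sup>2 + b\<^sup>2 + 2 * (a * b * c)"
      using sd by (simp add: abc(1,2) power2_norm_eq_inner inner_add_left inner_add_right inner_commute)
    then show "(norm (s + d))\<^sup>2 = (1 - (1 + c) / 2) * (a - b)\<^sup>2 + (1 + c) / 2 * (a + b)\<^sup>2"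
      by (simp add: power2_eq_square field_simps)
  qed (use c1 in auto)
  also have "\<dots> = cosh a * cosh b + c * (sinh a * sinh b)"
    by (simp add: cosh_add cosh_diff field_simps)
  also have "\<dots> \<le> cosh a + c * (sinh a * b) + cosh a * psiP b"
  proof -
    have "c * sinh a \<le> 1 * cosh a"
      using c1 a0 by (intro order.trans[OF mult_right_mono[of c 1]]) (auto simp: sinh_le_cosh_real)
    then have "(c * sinh a) * (sinh b - b) \<le> cosh a * (sinh b - b)"
      using le_sinh[OF b0] by (intro mult_right_mono) auto
    then show ?thesis
      unfolding psiP_def sinh_plus_cosh[symmetric] by (simp add: algebra_simps)
  qed
  also have "c * (sinh a * b) = (sinh (norm s) / norm s) * (s \<bullet> d)"
    unfolding sd by (simp add: abc(1))
  finally show ?thesis by (simp add: abc)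
qed

lemma psiP_nonneg: "0 \<le> psiP x"
  unfolding psiP_def using exp_ge_add_one_self[of x] by linarith

text \<open>
  Compare the power series \<open>\<Sum>k. z ^ (k + 2) / (k + 2)!\<close> of \<open>psiP\<close> term by term. Together with a bound by 1 on
  the increments this turns the exponential moment of an increment into its variance.
\<close>

lemma psiP_mult_le:
  fixes x y :: real
  assumes "0 \<le> x" "0 \<le> y" "y \<le> 1"
  shows "psiP (x * y) \<le> y\<^sup>2 * psiP x"
proof -
  have tail: "(\<lambda>n. z ^ (n + 2) /\<^sub>R fact (n + 2)) sums psiP z" for z :: real
    using sums_split_initial_segment[OF exp_converges[of z], of 2]
    by (simp add: psiP_def numeral_2_eq_2 algebra_simps)
  show ?thesis
  proof (rule sums_le[OF _ tail sums_mult[OF tail]])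
    fix n
    have "x ^ (n + 2) * (y\<^sup>2 * y ^ n) \<le> x ^ (n + 2) * (y\<^sup>2 * 1)"
      using assms by (intro mult_left_mono power_le_one) auto
    then have "(x * y) ^ (n + 2) \<le> y\<^sup>2 * x ^ (n + 2)"
      by (simp only: power_mult_distrib power_add mult_ac mult_1_right)
    then have "(x * y) ^ (n + 2) / fact (n + 2) \<le> y\<^sup>2 * x ^ (n + 2) / fact (n + 2)"
      by (rule divide_right_mono) (rule fact_ge_zero)
    then show "(x * y) ^ (n + 2) /\<^sub>R fact (n + 2) \<le> y\<^sup>2 * (x ^ (n + 2) /\<^sub>R fact (n + 2))"
      by (simp only: real_scaleR_def divide_inverse mult_ac)
  qed
qed

text \<open>
  Fan's inequality: the penalty \<open>psiE l * x\<^sup>2\<close> pushes the exponential \<open>exp (l * x)\<close> below its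
  tangent \<open>1 + l * x\<close> at \<open>x = 0\<close>. After taking
  logarithms the difference of both sides vanishes at \<open>l = 0\<close>, and its derivative in l is
  \<open>l * x\<^sup>2 * (1 / (1 - l) - 1 / (1 + l * x))\<close>, which is nonnegative because \<open>1 - l \<le> 1 + l * x\<close>.
\<close>

lemma exp_psiE_le:
  fixes l x :: real
  assumes l: "0 \<le> l" "l < 1" and x: "-1 \<le> x"
  shows "exp (l * x - psiE l * x\<^sup>2) \<le> 1 + l * x"
proof -
  have pos: "1 - m \<le> 1 + m * x" if "0 \<le> m" for m
    using mult_left_mono[OF x that] by simp
  define h where "h m = ln (1 + m * x) - m * x + psiE m * x\<^sup>2" for m
  have "h 0 \<le> h l"
  proof (rule DERIV_nonneg_imp_nondecreasing[OF l(1)])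
    fix m assume m: "0 \<le> m" "m \<le> l"
    then have m1: "0 < 1 - m" and p: "0 < 1 + m * x" using l pos[of m] by auto
    have "(h has_real_derivative x / (1 + m * x) - x + (1 / (1 - m) - 1) * x\<^sup>2) (at m)"
      unfolding h_def psiE_def using m1 p by (auto intro!: derivative_eq_intros simp: field_simps)
    moreover have "x / (1 + m * x) - x + (1 / (1 - m) - 1) * x\<^sup>2
        = m * x\<^sup>2 * (1 / (1 - m) - 1 / (1 + m * x))"
    proof -
      have "x / (1 + m * x) - x = - (m * x\<^sup>2) * (1 / (1 + m * x))"
        using p by (simp add: field_simps power2_eq_square)
      moreover have "(1 / (1 - m) - 1) * x\<^sup>2 = m * x\<^sup>2 * (1 / (1 - m))"
        using m1 by (simp add: field_simps)
      ultimately show ?thesis by (simp only: right_diff_distrib) simp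
    qed
    moreover have "0 \<le> m * x\<^sup>2 * (1 / (1 - m) - 1 / (1 + m * x))"
      using m m1 p pos[of m] by (intro mult_nonneg_nonneg) (auto intro!: divide_left_mono)
    ultimately show "\<exists>d. (h has_real_derivative d) (at m) \<and> 0 \<le> d" by metis
  qed
  then have "l * x - psiE l * x\<^sup>2 \<le> ln (1 + l * x)"
    by (simp add: h_def psiE_def)
  moreover have "0 < 1 + l * x" using pos[of l] l by simp
  ultimately show ?thesis by (metis exp_le_cancel_iff exp_ln)
qed



section \<open>Conditional expectation of quadratic expressions\<close>

text \<open>
  A single centred observation given the past F. Centring is expressed by integrals over the events of
  the subalgebra, the defining property of a vanishing Bochner conditional expectation.
\<close>

locale centred_variable = finite_measure_subalgebra M F + prob_space M
  for M F :: "'w measure" +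
  fixes Z :: "'w \<Rightarrow> 'h::{real_inner, banach, second_countable_topology}" and v :: real
  assumes Z_measurable [measurable]: "Z \<in> borel_measurable M"
    and Z_bounded: "AE \<omega> in M. norm (Z \<omega>) \<le> 1"
    and Z_centred: "\<And>A. A \<in> sets F \<Longrightarrow> (\<integral>\<omega>. indicator A \<omega> *\<^sub>R Z \<omega> \<partial>M) = 0"
    and Z_variance: "AE \<omega> in M. real_cond_exp M F (\<lambda>\<omega>. (norm (Z \<omega>))\<^sup>2) \<omega> = v"
begin

lemma measurable_F_M: "f \<in> measurable F N \<Longrightarrow> f \<in> measurable M N"
  by (rule measurable_from_subalg[OF subalg])

lemma sets_F_M: "A \<in> sets F \<Longrightarrow> A \<in> sets M"
  using subalg unfolding subalgebra_def by auto

text \<open>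
  For \<open>V = indicator A *\<^sub>R c\<close> this is the centring assumption; the general case follows by linearity and by
  dominated convergence, where the bound on Z makes the norm of V a majorant.
\<close>

lemma integral_inner_eq_0:
  assumes V: "integrable M V" "V \<in> borel_measurable F"
  shows "(\<integral>\<omega>. V \<omega> \<bullet> Z \<omega> \<partial>M) = 0"
proof -
  have int: "integrable M (\<lambda>\<omega>. U \<omega> \<bullet> Z \<omega>)" if "integrable M U" for U
  proof (rule Bochner_Integration.integrable_bound[OF that])
    show "AE \<omega> in M. norm (U \<omega> \<bullet> Z \<omega>) \<le> norm (U \<omega>)"
      using Z_bounded
    proof eventually_elim
      case (elim \<omega>)
      have "norm (U \<omega> \<bullet> Z \<omega>) \<le> norm (U \<omega>) * norm (Z \<omega>)"
        by (simp add: Cauchy_Schwarz_ineq2)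
      also have "\<dots> \<le> norm (U \<omega>) * 1" using elim by (intro mult_left_mono) auto
      finally show ?case by simp
    qed
  qed (use that in measurable)
  have "integrable (restr_to_subalg M F) V"
    by (rule integrable_in_subalg[OF subalg V(2,1)])
  then show ?thesis
  proof (induction V rule: integrable_induct)
    case (base A c)
    then have A: "A \<in> sets F" by (simp add: sets_restr_to_subalg[OF subalg])
    have Ai: "integrable M (\<lambda>\<omega>. indicator A \<omega> *\<^sub>R Z \<omega>)"
      by (rule integrable_const_bound[where B = 1])
         (use Z_bounded sets_F_M[OF A] in \<open>auto simp: indicator_def\<close>)
    have "(\<integral>\<omega>. (indicator A \<omega> *\<^sub>R c) \<bullet> Z \<omega> \<partial>M) = (\<integral>\<omega>. c \<bullet> (indicator A \<omega> *\<^sub>R Z \<omega>) \<partial>M)"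
      by (simp add: inner_commute)
    also have "\<dots> = c \<bullet> (\<integral>\<omega>. indicator A \<omega> *\<^sub>R Z \<omega> \<partial>M)"
      using Ai by (rule integral_inner_right)
    finally show ?case by (simp add: Z_centred[OF A])
  next
    case (add f g)
    then show ?case
      using int[OF integrable_from_subalg[OF subalg add.hyps(1)]]
        int[OF integrable_from_subalg[OF subalg add.hyps(2)]]
      by (simp add: inner_add_left)
  next
    case (lim f s)
    note intM = integrable_from_subalg[OF subalg]
    have sp: "space (restr_to_subalg M F) = space M"
      by (rule space_restr_to_subalg)
    have [measurable]: "f \<in> borel_measurable M" "\<And>i. s i \<in> borel_measurable M"
      using intM[OF lim.hyps(1)] intM[OF lim.hyps(4)] by auto
    have "(\<lambda>i. \<integral>\<omega>. s i \<omega> \<bullet> Z \<omega> \<partial>M) \<longlonglongrightarrow> (\<integral>\<omega>. f \<omega> \<bullet> Z \<omega> \<partial>M)"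
    proof (rule integral_dominated_convergence)
      show "integrable M (\<lambda>\<omega>. 2 * norm (f \<omega>))"
        using intM[OF lim.hyps(4)] by auto
      show "AE \<omega> in M. (\<lambda>i. s i \<omega> \<bullet> Z \<omega>) \<longlonglongrightarrow> f \<omega> \<bullet> Z \<omega>"
        using lim.hyps(2) unfolding sp by (intro AE_I2 tendsto_inner) auto
      show "AE \<omega> in M. norm (s i \<omega> \<bullet> Z \<omega>) \<le> 2 * norm (f \<omega>)" for i
        using Z_bounded AE_space
      proof eventually_elim
        case (elim \<omega>)
        have "norm (s i \<omega> \<bullet> Z \<omega>) \<le> norm (s i \<omega>) * norm (Z \<omega>)"
          by (simp add: Cauchy_Schwarz_ineq2)
        also have "\<dots> \<le> (2 * norm (f \<omega>)) * 1"
          using elim lim.hyps(3)[of \<omega> i] sp by (intro mult_mono) auto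
        finally show ?case by simp
      qed
    qed measurable
    then show ?case
      using lim.IH by (simp add: LIMSEQ_const_iff)
  qed
qed

text \<open>
  A nonnegative variable below a quadratic expression in Z, with coefficients known to the subalgebra, has a
  conditional expectation at most \<open>P + Q * v\<close>: the linear term averages out. In
  the application the weights, and hence the coefficients, can be unbounded, so the claim is about
  nonnegative integrals over events; by monotone convergence it is enough to prove it on the
  events on which the coefficients are bounded by n.
\<close>

lemma quadratic_conditional_bound:
  fixes G U P Q :: "'w \<Rightarrow> real" and V :: "'w \<Rightarrow> 'h"
  assumes G [measurable]: "G \<in> borel_measurable M" and G0: "\<And>\<omega>. 0 \<le> G \<omega>"
    and F_measurable [measurable]: "P \<in> borel_measurable F" "Q \<in> borel_measurable F"
      "V \<in> borel_measurable F" "U \<in> borel_measurable F"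
    and bound: "AE \<omega> in M. G \<omega> \<le> P \<omega> + V \<omega> \<bullet> Z \<omega> + Q \<omega> * (norm (Z \<omega>))\<^sup>2"
    and mean: "AE \<omega> in M. P \<omega> + Q \<omega> * v \<le> U \<omega>"
    and U0: "\<And>\<omega>. 0 \<le> U \<omega>"
    and A [measurable]: "A \<in> sets F"
  shows "(\<integral>\<^sup>+\<omega>. ennreal (G \<omega>) * indicator A \<omega> \<partial>M) \<le> (\<integral>\<^sup>+\<omega>. ennreal (U \<omega>) * indicator A \<omega> \<partial>M)"
proof -
  note M_measurable [measurable] = F_measurable[THEN measurable_F_M]
  have spF: "space F = space M" using subalg by (simp add: subalgebra_def)
  \<comment> \<open>Truncation: T n belongs to the subalgebra, so it can be absorbed into A.\<close>
  define T where "T n = {\<omega> \<in> space F. \<bar>P \<omega>\<bar> \<le> real n \<and> \<bar>Q \<omega>\<bar> \<le> real n \<and> norm (V \<omega>) \<le> real n \<and> U \<omega> \<le> real n}" for n :: nat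
  have TF [measurable]: "T n \<in> sets F" for n unfolding T_def by measurable
  define C where "C n = A \<inter> T n" for n
  have CF [measurable]: "C n \<in> sets F" for n unfolding C_def by measurable
  have CM: "C n \<in> sets M" for n using CF sets_F_M by blast
  have incseqC: "incseq C"
    unfolding C_def T_def incseq_def by (auto; meson of_nat_mono order.trans)
  have UNC: "(\<Union>n. C n) = A"
  proof -
    have "\<exists>n. \<omega> \<in> T n" if "\<omega> \<in> A" for \<omega>
    proof -
      obtain n where "max (max \<bar>P \<omega>\<bar> \<bar>Q \<omega>\<bar>) (max (norm (V \<omega>)) (U \<omega>)) \<le> real n"
        using real_arch_simple by blast
      then show ?thesis
        unfolding T_def using sets.sets_into_space[OF A] that by (intro exI[of _ n]) auto
    qed
    then show ?thesis unfolding C_def by blast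
  qed
  have Zb: "integrable M (\<lambda>\<omega>. f \<omega> * (norm (Z \<omega>))\<^sup>2)"
    if [measurable]: "f \<in> borel_measurable M" and fK: "\<And>\<omega>. \<bar>f \<omega>\<bar> \<le> K" for f :: "'w \<Rightarrow> real" and K
  proof (rule integrable_const_bound[where B = K])
    show "AE \<omega> in M. norm (f \<omega> * (norm (Z \<omega>))\<^sup>2) \<le> K"
      using Z_bounded
    proof eventually_elim
      case (elim \<omega>)
      have "norm (f \<omega> * (norm (Z \<omega>))\<^sup>2) \<le> K * 1"
        unfolding real_norm_def abs_mult
      proof (rule mult_mono)
        show "\<bar>f \<omega>\<bar> \<le> K" by (rule fK)
        then show "0 \<le> K" by linarith
        show "\<bar>(norm (Z \<omega>))\<^sup>2\<bar> \<le> 1" using elim by (simp add: power_le_one)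
      qed simp
      then show ?case by simp
    qed
  qed measurable
  have trunc: "(\<integral>\<^sup>+\<omega>. ennreal (G \<omega>) * indicator (C n) \<omega> \<partial>M)
      \<le> (\<integral>\<^sup>+\<omega>. ennreal (U \<omega>) * indicator (C n) \<omega> \<partial>M)" for n
  proof -
    define I where "I \<omega> = (indicator (C n) \<omega> :: real)" for \<omega>
    have I_F [measurable]: "I \<in> borel_measurable F"
      unfolding I_def using CF by measurable
    have I_M [measurable]: "I \<in> borel_measurable M"
      by (rule measurable_F_M[OF I_F])
    have bP: "\<bar>I \<omega> * P \<omega>\<bar> \<le> real n" and bQ: "\<bar>I \<omega> * Q \<omega>\<bar> \<le> real n"
      and bV: "norm (I \<omega> *\<^sub>R V \<omega>) \<le> real n" and bU: "\<bar>I \<omega> * U \<omega>\<bar> \<le> real n" for \<omega>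
      using U0[of \<omega>] by (cases "\<omega> \<in> C n"; simp add: I_def C_def T_def)+
    have iP: "integrable M (\<lambda>\<omega>. I \<omega> * P \<omega>)"
      by (rule integrable_const_bound[where B = "real n"]) (use bP in auto)
    have iU: "integrable M (\<lambda>\<omega>. I \<omega> * U \<omega>)"
      by (rule integrable_const_bound[where B = "real n"]) (use bU in auto)
    have iV: "integrable M (\<lambda>\<omega>. I \<omega> *\<^sub>R V \<omega>)"
      by (rule integrable_const_bound[where B = "real n"]) (use bV in auto)
    have iQ: "integrable M (\<lambda>\<omega>. (I \<omega> * Q \<omega>) * (norm (Z \<omega>))\<^sup>2)"
      by (rule Zb[OF _ bQ]) measurable
    have iQv: "integrable M (\<lambda>\<omega>. (I \<omega> * Q \<omega>) * v)"
      by (intro integrable_mult_left integrable_const_bound[where B = "real n"]) (use bQ in auto)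
    have iVZ: "integrable M (\<lambda>\<omega>. (I \<omega> *\<^sub>R V \<omega>) \<bullet> Z \<omega>)"
    proof (rule Bochner_Integration.integrable_bound[OF iV])
      show "AE \<omega> in M. norm ((I \<omega> *\<^sub>R V \<omega>) \<bullet> Z \<omega>) \<le> norm (I \<omega> *\<^sub>R V \<omega>)"
        using Z_bounded
      proof eventually_elim
        case (elim \<omega>)
        show ?case
          using order.trans[OF Cauchy_Schwarz_ineq2[of "I \<omega> *\<^sub>R V \<omega>" "Z \<omega>"]
              mult_left_mono[OF elim, of "norm (I \<omega> *\<^sub>R V \<omega>)"]] by simp
      qed
    qed measurable
    let ?rhs = "\<lambda>\<omega>. I \<omega> * P \<omega> + (I \<omega> *\<^sub>R V \<omega>) \<bullet> Z \<omega> + (I \<omega> * Q \<omega>) * (norm (Z \<omega>))\<^sup>2"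
    have GI: "AE \<omega> in M. I \<omega> * G \<omega> \<le> ?rhs \<omega>"
      using bound by eventually_elim (auto simp: I_def indicator_def)
    have iG: "integrable M (\<lambda>\<omega>. I \<omega> * G \<omega>)"
    proof (rule Bochner_Integration.integrable_bound)
      show "integrable M ?rhs" using iP iVZ iQ by auto
      show "AE \<omega> in M. norm (I \<omega> * G \<omega>) \<le> norm (?rhs \<omega>)"
        using GI
      proof eventually_elim
        case (elim \<omega>)
        have "0 \<le> I \<omega> * G \<omega>" using G0[of \<omega>] by (simp add: I_def)
        then show ?case using elim by (simp only: real_norm_def)
      qed
    qed measurable
    have "(\<integral>\<omega>. I \<omega> * G \<omega> \<partial>M) \<le> (\<integral>\<omega>. ?rhs \<omega> \<partial>M)"
      by (intro integral_mono_AE[OF iG _ GI] Bochner_Integration.integrable_add iP iVZ iQ)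
    also have "\<dots> = (\<integral>\<omega>. I \<omega> * P \<omega> \<partial>M) + (\<integral>\<omega>. (I \<omega> *\<^sub>R V \<omega>) \<bullet> Z \<omega> \<partial>M)
        + (\<integral>\<omega>. (I \<omega> * Q \<omega>) * (norm (Z \<omega>))\<^sup>2 \<partial>M)"
      by (simp only: Bochner_Integration.integral_add iP iVZ iQ Bochner_Integration.integrable_add)
    also have "(\<integral>\<omega>. (I \<omega> *\<^sub>R V \<omega>) \<bullet> Z \<omega> \<partial>M) = 0"
      by (rule integral_inner_eq_0[OF iV]) measurable
    also have "(\<integral>\<omega>. (I \<omega> * Q \<omega>) * (norm (Z \<omega>))\<^sup>2 \<partial>M)
        = (\<integral>\<omega>. (I \<omega> * Q \<omega>) * real_cond_exp M F (\<lambda>\<omega>. (norm (Z \<omega>))\<^sup>2) \<omega> \<partial>M)"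
      by (rule real_cond_exp_intg(2)[symmetric, OF iQ]) measurable
    also have "\<dots> = (\<integral>\<omega>. (I \<omega> * Q \<omega>) * v \<partial>M)"
    proof (rule integral_cong_AE)
      show "AE \<omega> in M. (I \<omega> * Q \<omega>) * real_cond_exp M F (\<lambda>\<omega>. (norm (Z \<omega>))\<^sup>2) \<omega> = (I \<omega> * Q \<omega>) * v"
        using Z_variance by eventually_elim simp
    qed measurable
    also have "(\<integral>\<omega>. I \<omega> * P \<omega> \<partial>M) + 0 + \<dots> = (\<integral>\<omega>. I \<omega> * P \<omega> + (I \<omega> * Q \<omega>) * v \<partial>M)"
      by (simp only: Bochner_Integration.integral_add[OF iP iQv] add_0_right)
    also have "\<dots> \<le> (\<integral>\<omega>. I \<omega> * U \<omega> \<partial>M)"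
    proof (rule integral_mono_AE[OF _ iU])
      show "AE \<omega> in M. I \<omega> * P \<omega> + (I \<omega> * Q \<omega>) * v \<le> I \<omega> * U \<omega>"
        using mean by eventually_elim (auto simp: I_def indicator_def)
    qed (intro Bochner_Integration.integrable_add iP iQv)
    finally have le: "(\<integral>\<omega>. I \<omega> * G \<omega> \<partial>M) \<le> (\<integral>\<omega>. I \<omega> * U \<omega> \<partial>M)" .
    have conv: "(\<integral>\<^sup>+\<omega>. ennreal (f \<omega>) * indicator (C n) \<omega> \<partial>M) = ennreal (\<integral>\<omega>. I \<omega> * f \<omega> \<partial>M)"
      if f0: "\<forall>\<omega>. 0 \<le> f \<omega>" and f_int: "integrable M (\<lambda>\<omega>. I \<omega> * f \<omega>)" for f
    proof -
      have "(\<integral>\<^sup>+\<omega>. ennreal (f \<omega>) * indicator (C n) \<omega> \<partial>M) = (\<integral>\<^sup>+\<omega>. ennreal (I \<omega> * f \<omega>) \<partial>M)"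
      proof (rule nn_integral_cong)
        show "ennreal (f \<omega>) * indicator (C n) \<omega> = ennreal (I \<omega> * f \<omega>)" for \<omega>
          by (cases "\<omega> \<in> C n") (simp_all add: I_def)
      qed
      also have "\<dots> = ennreal (\<integral>\<omega>. I \<omega> * f \<omega> \<partial>M)"
      proof (rule nn_integral_eq_integral[OF f_int])
        show "AE \<omega> in M. 0 \<le> I \<omega> * f \<omega>"
          using f0 unfolding I_def by (intro AE_I2 mult_nonneg_nonneg) simp_all
      qed
      finally show ?thesis .
    qed
    have "\<forall>\<omega>. 0 \<le> G \<omega>" "\<forall>\<omega>. 0 \<le> U \<omega>" using G0 U0 by auto
    note conv_GU = conv[OF this(1) iG] conv[OF this(2) iU]
    show ?thesis
      unfolding conv_GU using le by (rule ennreal_leI)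
  qed
  have U_M: "(\<lambda>\<omega>. ennreal (U \<omega>)) \<in> borel_measurable M" by measurable
  have G_M: "(\<lambda>\<omega>. ennreal (G \<omega>)) \<in> borel_measurable M" by measurable
  have lim: "(\<lambda>n. \<integral>\<^sup>+\<omega>. f \<omega> * indicator (C n) \<omega> \<partial>M) \<longlonglongrightarrow> (\<integral>\<^sup>+\<omega>. f \<omega> * indicator A \<omega> \<partial>M)"
    if f: "f \<in> borel_measurable M" for f :: "'w \<Rightarrow> ennreal"
    using Lim_emeasure_incseq[of C "density M f"] incseqC CM
    by (simp add: emeasure_density[OF f CM] UNC emeasure_density[OF f sets_F_M[OF A]] image_subset_iff)
  show ?thesis
    by (rule LIMSEQ_le[OF lim[OF G_M] lim[OF U_M]]) (use trunc in auto)
qed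

end

section \<open>The maximal inequality of Ville\<close>

text \<open>
  Stop the supermartingale at the first time that W reaches c. The quantity
  \<open>c * P(W has reached c by time n) + E(W n; W has stayed below c up to time n)\<close> does not increase in n:
  in each step the paths that newly reach c contribute at least c to the expectation.
\<close>

lemma (in prob_space) ville_inequality:
  fixes W :: "nat \<Rightarrow> 'a \<Rightarrow> real" and F :: "nat \<Rightarrow> 'a measure" and c :: real
  assumes sub: "\<And>n. subalgebra M (F n)"
    and mono: "\<And>n. sets (F n) \<subseteq> sets (F (Suc n))"
    and adapted: "\<And>n. W n \<in> borel_measurable (F n)"
    and init: "(\<integral>\<^sup>+\<omega>. ennreal (W 0 \<omega>) \<partial>M) \<le> 1"
    and step: "\<And>n A. A \<in> sets (F n) \<Longrightarrow>
      (\<integral>\<^sup>+\<omega>. ennreal (W (Suc n) \<omega>) * indicator A \<omega> \<partial>M) \<le> (\<integral>\<^sup>+\<omega>. ennreal (W n \<omega>) * indicator A \<omega> \<partial>M)"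
    and c: "0 < c"
  shows "prob {\<omega> \<in> space M. \<exists>n. c \<le> W n \<omega>} \<le> 1 / c"
proof -
  have spF: "space (F n) = space M" for n using sub[of n] by (simp add: subalgebra_def)
  have FM: "sets (F n) \<subseteq> sets M" for n using sub[of n] by (simp add: subalgebra_def)
  have WM [measurable]: "W n \<in> borel_measurable M" for n
    using measurable_from_subalg[OF sub adapted] .
  define below where "below n = {\<omega> \<in> space M. \<forall>k\<le>n. W k \<omega> < c}" for n
  define hit where "hit n = {\<omega> \<in> space M. \<exists>k\<le>n. c \<le> W k \<omega>}" for n
  have belowF: "below n \<in> sets (F n)" for n
  proof (induction n)
    case 0
    have "{\<omega> \<in> space (F 0). W 0 \<omega> < c} \<in> sets (F 0)" using adapted[of 0] by measurable
    then show ?case by (simp add: below_def spF)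
  next
    case (Suc n)
    have "{\<omega> \<in> space (F (Suc n)). W (Suc n) \<omega> < c} \<in> sets (F (Suc n))"
      using adapted[of "Suc n"] by measurable
    moreover have "below (Suc n) = below n \<inter> {\<omega> \<in> space (F (Suc n)). W (Suc n) \<omega> < c}"
      unfolding below_def spF by (auto simp: le_Suc_eq)
    ultimately show ?case using Suc.IH mono[of n] by auto
  qed
  have belowM [measurable]: "below n \<in> sets M" for n using belowF FM by blast
  have hitM [measurable]: "hit n \<in> sets M" for n unfolding hit_def by measurable
  have stopped: "ennreal c * emeasure M (hit n) + (\<integral>\<^sup>+\<omega>. ennreal (W n \<omega>) * indicator (below n) \<omega> \<partial>M) \<le> 1" for n
  proof (induction n)
    case 0
    have "ennreal c * emeasure M (hit 0) + (\<integral>\<^sup>+\<omega>. ennreal (W 0 \<omega>) * indicator (below 0) \<omega> \<partial>M)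
        = (\<integral>\<^sup>+\<omega>. ennreal c * indicator (hit 0) \<omega> + ennreal (W 0 \<omega>) * indicator (below 0) \<omega> \<partial>M)"
      by (simp add: nn_integral_add nn_integral_cmult)
    also have "\<dots> \<le> (\<integral>\<^sup>+\<omega>. ennreal (W 0 \<omega>) \<partial>M)"
    proof (rule nn_integral_mono)
      have "hit 0 = {\<omega> \<in> space M. c \<le> W 0 \<omega>}" "below 0 = {\<omega> \<in> space M. W 0 \<omega> < c}"
        by (auto simp: hit_def below_def)
      then show "ennreal c * indicator (hit 0) \<omega> + ennreal (W 0 \<omega>) * indicator (below 0) \<omega>
          \<le> ennreal (W 0 \<omega>)" for \<omega>
        by (cases "\<omega> \<in> space M"; cases "c \<le> W 0 \<omega>") (simp_all add: ennreal_leI)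
    qed
    finally show ?case using init by simp
  next
    case (Suc n)
    define new where "new = hit (Suc n) - hit n"
    have [measurable]: "new \<in> sets M" unfolding new_def by measurable
    have hs: "emeasure M (hit (Suc n)) = emeasure M (hit n) + emeasure M new"
    proof -
      have "hit n \<subseteq> hit (Suc n)" unfolding hit_def by (auto intro: le_SucI)
      then have "hit (Suc n) = hit n \<union> new" "hit n \<inter> new = {}" unfolding new_def by auto
      then show ?thesis using plus_emeasure[of "hit n" M new] by simp
    qed
    have "ennreal c * emeasure M new + (\<integral>\<^sup>+\<omega>. ennreal (W (Suc n) \<omega>) * indicator (below (Suc n)) \<omega> \<partial>M)
        = (\<integral>\<^sup>+\<omega>. ennreal c * indicator new \<omega> + ennreal (W (Suc n) \<omega>) * indicator (below (Suc n)) \<omega> \<partial>M)"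
      by (simp add: nn_integral_add nn_integral_cmult)
    also have "\<dots> \<le> (\<integral>\<^sup>+\<omega>. ennreal (W (Suc n) \<omega>) * indicator (below n) \<omega> \<partial>M)"
    proof (rule nn_integral_mono)
      have below_Suc: "below (Suc n) = {\<omega> \<in> below n. W (Suc n) \<omega> < c}"
        unfolding below_def by (auto simp: le_Suc_eq)
      have hit_eq: "hit k = space M - below k" for k
        unfolding hit_def below_def by (auto simp: not_less)
      have "below n \<subseteq> space M"
        unfolding below_def by auto
      then have "new = {\<omega> \<in> below n. c \<le> W (Suc n) \<omega>}"
        unfolding new_def hit_eq below_Suc by (auto simp: not_less)
      then show "ennreal c * indicator new \<omega> + ennreal (W (Suc n) \<omega>) * indicator (below (Suc n)) \<omega>
          \<le> ennreal (W (Suc n) \<omega>) * indicator (below n) \<omega>" for \<omega>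
        unfolding below_Suc
        by (cases "\<omega> \<in> below n"; cases "c \<le> W (Suc n) \<omega>") (simp_all add: ennreal_leI)
    qed
    also have "\<dots> \<le> (\<integral>\<^sup>+\<omega>. ennreal (W n \<omega>) * indicator (below n) \<omega> \<partial>M)"
      by (rule step[OF belowF])
    finally have "ennreal c * emeasure M (hit n) + (ennreal c * emeasure M new
          + (\<integral>\<^sup>+\<omega>. ennreal (W (Suc n) \<omega>) * indicator (below (Suc n)) \<omega> \<partial>M))
        \<le> ennreal c * emeasure M (hit n) + (\<integral>\<^sup>+\<omega>. ennreal (W n \<omega>) * indicator (below n) \<omega> \<partial>M)"
      by (rule add_left_mono)
    also have "\<dots> \<le> 1"
      by (rule Suc.IH)
    finally show ?case
      unfolding hs distrib_left add.assoc .
  qed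
  have hit_le: "prob (hit n) \<le> 1 / c" for n
  proof -
    have "ennreal c * emeasure M (hit n) \<le> 1"
      using stopped[of n] by (meson le_iff_add order.trans)
    then have "c * prob (hit n) \<le> 1"
      using c by (simp add: emeasure_eq_measure ennreal_mult[symmetric] flip: ennreal_1)
    then show ?thesis using c by (simp add: field_simps)
  qed
  have "incseq hit" unfolding hit_def incseq_def by (auto intro: order.trans)
  then have "(\<lambda>n. prob (hit n)) \<longlonglongrightarrow> prob (\<Union>n. hit n)"
    by (intro finite_Lim_measure_incseq) auto
  then have "prob (\<Union>n. hit n) \<le> 1 / c"
    by (rule LIMSEQ_le_const2) (use hit_le in auto)
  moreover have "(\<Union>n. hit n) = {\<omega> \<in> space M. \<exists>n. c \<le> W n \<omega>}" by (auto simp: hit_def)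
  ultimately show ?thesis by simp
qed



section \<open>The canonical filtration\<close>

lemma space_canonical_filtration [simp]: "space (canonical_filtration M X t) = space M"
  unfolding canonical_filtration_def by (rule space_measure_of) auto

lemma sets_canonical_filtration:
  "sets (canonical_filtration M X t) =
    sigma_sets (space M) {X i -` A \<inter> space M | i A. i \<in> {1..t} \<and> A \<in> sets borel}"
  unfolding canonical_filtration_def by (rule sets_measure_of) auto

lemma sets_canonical_filtration_mono:
  assumes "s \<le> t"
  shows "sets (canonical_filtration M X s) \<subseteq> sets (canonical_filtration M X t)"
  unfolding sets_canonical_filtration using assms by (intro sigma_sets_mono') fastforce

lemma canonical_filtration_adapted:
  assumes "1 \<le> i" "i \<le> t"
  shows "X i \<in> borel_measurable (canonical_filtration M X t)"
proof (rule measurableI)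
  show "X i -` A \<inter> space (canonical_filtration M X t) \<in> sets (canonical_filtration M X t)"
    if "A \<in> sets borel" for A
    using that assms unfolding sets_canonical_filtration space_canonical_filtration
    by (intro sigma_sets.Basic) auto
qed simp

lemma subalgebra_canonical_filtration:
  assumes "\<And>i. 1 \<le> i \<Longrightarrow> X i \<in> borel_measurable M"
  shows "subalgebra M (canonical_filtration M X t)"
  unfolding subalgebra_def sets_canonical_filtration space_canonical_filtration
  using assms by (intro conjI refl sets.sigma_sets_subset) (auto intro: measurable_sets)

lemma predictable_measurable:
  assumes "predictable (canonical_filtration M X) a" "1 \<le> i" "i \<le> Suc t"
  shows "a i \<in> borel_measurable (canonical_filtration M X t)"
proof -
  have "a i \<in> borel_measurable (canonical_filtration M X (i - 1))"
    using assms unfolding predictable_def by blast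
  then show ?thesis
    by (rule subsetD[OF measurable_mono, rotated -1])
       (use assms in \<open>auto intro!: sets_canonical_filtration_mono\<close>)
qed

section \<open>The quadratic inequality on a single path\<close>

text \<open>
  The error of the weighted mean is the weighted sum of the centred observations divided by the total weight.
  Squaring the deviation bound gives a quadratic polynomial in v with the three coefficients on the
  right. Without weight the estimate is 0, and \<open>1 / 4\<close> bounds the square of the norm of \<open>\<mu>\<close>.
\<close>

lemma norm_mu_hs_diff_le:
  fixes x :: "nat \<Rightarrow> 'h::real_inner"
  assumes lt: "\<And>i. 1 \<le> i \<Longrightarrow> 0 \<le> lt i" and mu: "norm \<mu> \<le> 1 / 2"
    and dev: "\<And>n. norm (\<Sum>i=1..n. lt i *\<^sub>R (x i - \<mu>)) \<le> ln (2 / \<delta>) + v * (\<Sum>i=1..n. psiP (lt i))"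
  shows "(norm (mu_hs lt x t - \<mu>))\<^sup>2 \<le> At_tilde lt t * v\<^sup>2 + Bt_tilde \<delta> lt t * v + Ct_tilde \<delta> lt t"
proof (cases "(\<Sum>i=1..<t. lt i) = 0")
  case True
  have "(norm \<mu>)\<^sup>2 \<le> (1 / 2)\<^sup>2" using mu by (intro power_mono) auto
  then show ?thesis
    using True by (simp add: mu_hs_def At_tilde_def Bt_tilde_def Ct_tilde_def power_divide)
next
  case False
  define N K \<Psi> where "N = (\<Sum>i=1..<t. lt i)" "K = ln (2 / \<delta>)" "\<Psi> = (\<Sum>i=1..<t. psiP (lt i))"
  note defs = this
  have N: "0 < N" using False lt sum_nonneg[of "{1..<t}" lt] by (auto simp: defs(1) order_less_le)
  have "mu_hs lt x t - \<mu> = (\<Sum>i=1..<t. lt i *\<^sub>R (x i - \<mu>)) /\<^sub>R N"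
  proof -
    have "(\<Sum>i=1..<t. lt i *\<^sub>R (x i - \<mu>)) = (\<Sum>i=1..<t. lt i *\<^sub>R x i) - N *\<^sub>R \<mu>"
      by (simp add: defs(1) scaleR_diff_right sum_subtractf scaleR_sum_left)
    then show ?thesis
      unfolding mu_hs_def defs(1)[symmetric] using N by (simp add: scaleR_diff_right)
  qed
  moreover have "{1..<t} = {1..t - 1}" by auto
  ultimately have "norm (mu_hs lt x t - \<mu>) \<le> (K + v * \<Psi>) / N"
    using dev[of "t - 1"] N by (simp add: defs(2,3) field_simps)
  then have "(norm (mu_hs lt x t - \<mu>))\<^sup>2 \<le> ((K + v * \<Psi>) / N)\<^sup>2"
    by (intro power_mono) auto
  also have "\<dots> = \<Psi>\<^sup>2 / N\<^sup>2 * v\<^sup>2 + 2 * K * \<Psi> / N\<^sup>2 * v + K\<^sup>2 / N\<^sup>2"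
    by (simp add: power2_eq_square add_divide_distrib algebra_simps)
  finally show ?thesis
    using False by (simp add: At_tilde_def Bt_tilde_def Ct_tilde_def defs)
qed

lemma quadratic_root_less:
  fixes a b k v :: real
  assumes a: "0 < a" and b: "0 < b" and v: "0 \<le> v" and less: "k < a * v\<^sup>2 + b * v"
  shows "(- b + sqrt (b\<^sup>2 + 4 * a * k)) / (2 * a) < v"
proof -
  have "4 * a * k < 4 * a * (a * v\<^sup>2 + b * v)"
    using a less by (intro mult_strict_left_mono) auto
  then have "b\<^sup>2 + 4 * a * k < (b + 2 * a * v)\<^sup>2"
    by (simp add: power2_eq_square algebra_simps)
  then have "sqrt (b\<^sup>2 + 4 * a * k) < b + 2 * a * v"
    using a b v by (intro real_less_lsqrt) auto
  then show ?thesis using a by (simp add: field_simps)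
qed

text \<open>
  The pathwise part of the argument. The bound \<open>sq\<close> compares the weighted squared residuals with
  \<open>v\<close> plus the squared errors of the mean estimates; inserting the bound for these errors yields the
  strict inequality \<open>D - C - R < A * v\<^sup>2 + B * v\<close>, so v exceeds the larger root of the quadratic equation,
  which is the lower limit. In the degenerate cases the limit is \<open>- \<infinity>\<close>.
\<close>

lemma L_hs_less:
  fixes x :: "nat \<Rightarrow> 'h::real_inner"
  assumes l: "\<And>i. 1 \<le> i \<Longrightarrow> 0 \<le> l i" and lt: "\<And>i. 1 \<le> i \<Longrightarrow> 0 \<le> lt i"
    and mu: "norm \<mu> \<le> 1 / 2" and v: "0 \<le> v" and \<delta>: "0 < \<delta>" "\<delta> \<le> 2"
    and dev: "\<And>n. norm (\<Sum>i=1..n. lt i *\<^sub>R (x i - \<mu>)) \<le> ln (2 / \<delta>) + v * (\<Sum>i=1..n. psiP (lt i))"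
    and sq: "(\<Sum>i=1..t. l i * ((norm (x i - mu_hs lt x i))\<^sup>2 - (v + (norm (mu_hs lt x i - \<mu>))\<^sup>2))
        - psiE (l i) * ((norm (x i - mu_hs lt x i))\<^sup>2 - s2 i)\<^sup>2) < ln (1 / \<delta>')"
  shows "L_hs \<delta> \<delta>' l lt s2 x t < ereal v"
proof -
  define N where "N = (\<Sum>i=1..t. l i)"
  define Y where "Y i = (norm (x i - mu_hs lt x i))\<^sup>2" for i
  define e where "e i = (norm (mu_hs lt x i - \<mu>))\<^sup>2" for i
  define a b c where "a = (\<Sum>i=1..t. l i * At_tilde lt i)"
    and "b = (\<Sum>i=1..t. l i * Bt_tilde \<delta> lt i)" and "c = (\<Sum>i=1..t. l i * Ct_tilde \<delta> lt i)"
  let ?A = "A_hs l lt t" and ?B = "B_hs \<delta> l lt t"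
    and ?K = "D_hs l lt x t - C_hs \<delta> l lt t - R_hs \<delta>' l lt s2 x t"
  show ?thesis
  proof (cases "N = 0 \<or> ?A = 0 \<or> ?B\<^sup>2 + 4 * ?A * ?K < 0")
    case True
    then show ?thesis unfolding L_hs_def Let_def N_def[symmetric] by auto
  next
    case False
    have "0 \<le> N" unfolding N_def by (intro sum_nonneg l) auto
    with False have N: "0 < N" by auto
    have "0 \<le> ln (2 / \<delta>)" using \<delta> by (intro ln_ge_zero) auto
    then have "0 \<le> At_tilde lt i" "0 \<le> Bt_tilde \<delta> lt i" for i
      by (auto simp: At_tilde_def Bt_tilde_def intro!: divide_nonneg_nonneg mult_nonneg_nonneg sum_nonneg psiP_nonneg)
    then have "0 \<le> a" "0 \<le> b"
      unfolding a_def b_def by (auto intro!: sum_nonneg mult_nonneg_nonneg l)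
    moreover have AB: "?A = a / N" "?B = 1 + b / N"
      unfolding A_hs_def B_hs_def a_def b_def N_def by (rule refl)+
    ultimately have "0 \<le> ?A" and B: "0 < ?B"
      using N by (simp_all add: add_pos_nonneg)
    with False have A: "0 < ?A" by auto
    have "(\<Sum>i=1..t. l i * e i) \<le> (\<Sum>i=1..t. l i * (At_tilde lt i * v\<^sup>2 + Bt_tilde \<delta> lt i * v + Ct_tilde \<delta> lt i))"
      unfolding e_def by (intro sum_mono mult_left_mono norm_mu_hs_diff_le[OF lt mu dev] l) auto
    also have "\<dots> = a * v\<^sup>2 + b * v + c"
      by (simp add: a_def b_def c_def distrib_left sum.distrib sum_distrib_right mult.assoc)
    finally have e: "(\<Sum>i=1..t. l i * e i) \<le> a * v\<^sup>2 + b * v + c" .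
    \<comment> \<open>Division of the summed inequality by N turns the sums into the weighted averages of the definitions.\<close>
    define d r where "d = (\<Sum>i=1..t. l i * Y i)" and "r = (\<Sum>i=1..t. psiE (l i) * (Y i - s2 i)\<^sup>2)"
    have "d - (N * v + (\<Sum>i=1..t. l i * e i)) - r < ln (1 / \<delta>')"
      using sq unfolding Y_def[symmetric] e_def[symmetric]
      by (simp add: d_def r_def N_def sum_subtractf sum.distrib right_diff_distrib distrib_left sum_distrib_right)
    with e have "d - c - (ln (1 / \<delta>') + r) < a * v\<^sup>2 + (N + b) * v"
      by (simp add: algebra_simps)
    then have "(d - c - (ln (1 / \<delta>') + r)) / N < (a * v\<^sup>2 + (N + b) * v) / N"
      using N by (rule divide_strict_right_mono)
    moreover have "?K = (d - c - (ln (1 / \<delta>') + r)) / N"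
      by (simp add: D_hs_def C_hs_def R_hs_def d_def c_def r_def N_def Y_def diff_divide_distrib)
    moreover have "?A * v\<^sup>2 + ?B * v = (a * v\<^sup>2 + (N + b) * v) / N"
      unfolding AB using N by (simp add: field_simps)
    ultimately have "?K < ?A * v\<^sup>2 + ?B * v" by simp
    from quadratic_root_less[OF A B v this] show ?thesis
      unfolding L_hs_def Let_def N_def[symmetric] using False by simp
  qed
qed

section \<open>Measurability\<close>

lemma psiE_measurable [measurable]: "psiE \<in> borel_measurable borel"
  unfolding psiE_def by measurable

lemma psiP_measurable [measurable]: "psiP \<in> borel_measurable borel"
  unfolding psiP_def by measurable

lemma mu_hs_measurable:
  fixes X :: "nat \<Rightarrow> 'w \<Rightarrow> 'h::{real_inner, banach, second_countable_topology}"
  assumes [measurable (raw)]: "\<And>i. 1 \<le> i \<Longrightarrow> i < t \<Longrightarrow> lt i \<in> borel_measurable N"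
    "\<And>i. 1 \<le> i \<Longrightarrow> i < t \<Longrightarrow> X i \<in> borel_measurable N"
  shows "(\<lambda>\<omega>. mu_hs (\<lambda>i. lt i \<omega>) (\<lambda>i. X i \<omega>) t) \<in> borel_measurable N"
  unfolding mu_hs_def by measurable

lemma L_hs_measurable:
  fixes X :: "nat \<Rightarrow> 'w \<Rightarrow> 'h::{real_inner, banach, second_countable_topology}"
  assumes [measurable (raw)]: "\<And>i. 1 \<le> i \<Longrightarrow> l i \<in> borel_measurable N"
    "\<And>i. 1 \<le> i \<Longrightarrow> lt i \<in> borel_measurable N" "\<And>i. 1 \<le> i \<Longrightarrow> s2 i \<in> borel_measurable N"
    "\<And>i. 1 \<le> i \<Longrightarrow> X i \<in> borel_measurable N"
  shows "(\<lambda>\<omega>. L_hs \<alpha>1 \<alpha>2 (\<lambda>i. l i \<omega>) (\<lambda>i. lt i \<omega>) (\<lambda>i. s2 i \<omega>) (\<lambda>i. X i \<omega>) t) \<in> borel_measurable N"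
proof -
  have [measurable]: "(\<lambda>\<omega>. mu_hs (\<lambda>i. lt i \<omega>) (\<lambda>i. X i \<omega>) i) \<in> borel_measurable N" for i
    by (rule mu_hs_measurable) measurable
  show ?thesis
    unfolding L_hs_def Let_def A_hs_def B_hs_def C_hs_def D_hs_def R_hs_def
      At_tilde_def Bt_tilde_def Ct_tilde_def by measurable
qed

section \<open>Two time-uniform deviation inequalities\<close>

lemma cosh_measurable [measurable]: "(cosh :: real \<Rightarrow> real) \<in> borel_measurable borel"
  by (intro borel_measurable_continuous_onI continuous_intros)

lemma sinh_measurable [measurable]: "(sinh :: real \<Rightarrow> real) \<in> borel_measurable borel"
  by (intro borel_measurable_continuous_onI continuous_intros)

locale constant_mean_variance = prob_space M
  for M :: "'w measure" +
  fixes X :: "nat \<Rightarrow> 'w \<Rightarrow> 'h::{real_inner, banach, second_countable_topology}"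
    and \<mu> :: 'h and v :: real
  assumes X_measurable: "\<And>t. 1 \<le> t \<Longrightarrow> X t \<in> borel_measurable M"
    and X_bounded: "\<And>t. 1 \<le> t \<Longrightarrow> AE \<omega> in M. norm (X t \<omega>) \<le> 1 / 2"
    and X_mean: "\<And>t. 1 \<le> t \<Longrightarrow> has_cond_exp M (canonical_filtration M X (t - 1)) (X t) (\<lambda>\<omega>. \<mu>)"
    and X_variance: "\<And>t. 1 \<le> t \<Longrightarrow>
      AE \<omega> in M. real_cond_exp M (canonical_filtration M X (t - 1)) (\<lambda>\<omega>. (norm (X t \<omega> - \<mu>))\<^sup>2) \<omega> = v"
begin

abbreviation F :: "nat \<Rightarrow> 'w measure" where
  "F \<equiv> canonical_filtration M X"

lemma subalgebra_F: "subalgebra M (F t)"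
  by (rule subalgebra_canonical_filtration) (rule X_measurable)

lemma F_measurable_M: "f \<in> measurable (F t) N \<Longrightarrow> f \<in> measurable M N"
  by (rule measurable_from_subalg[OF subalgebra_F])

text \<open>
  Conditioning on the trivial \<sigma>-algebra at time 0 gives \<open>\<mu> = E (X 1)\<close>.
\<close>

lemma norm_mean_le: "norm \<mu> \<le> 1 / 2"
proof -
  have ce: "integrable M (X 1)"
    "\<forall>A\<in>sets (F 0). set_lebesgue_integral M A (X 1) = set_lebesgue_integral M A (\<lambda>\<omega>. \<mu>)"
    using X_mean[of 1] by (auto simp: has_cond_exp_def)
  have "space M \<in> sets (F 0)" by (metis sets.top space_canonical_filtration)
  with ce(2) have "(\<integral>\<omega>. X 1 \<omega> \<partial>M) = \<mu>"
    using set_integral_space[OF ce(1)] set_integral_space[of M "\<lambda>\<omega>. \<mu>"] by (simp add: prob_space)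
  moreover have "norm (\<integral>\<omega>. X 1 \<omega> \<partial>M) \<le> (\<integral>\<omega>. norm (X 1 \<omega>) \<partial>M)" by simp
  moreover have "(\<integral>\<omega>. norm (X 1 \<omega>) \<partial>M) \<le> (\<integral>\<omega>. 1 / 2 \<partial>M)"
    by (rule integral_mono_AE) (use ce(1) X_bounded[of 1] in auto)
  ultimately show ?thesis by (simp add: prob_space)
qed

lemma centred_variable_X: "centred_variable M (F n) (\<lambda>\<omega>. X (Suc n) \<omega> - \<mu>) v"
proof unfold_locales
  have ce: "integrable M (X (Suc n))"
    "A \<in> sets (F n) \<Longrightarrow> set_lebesgue_integral M A (X (Suc n)) = set_lebesgue_integral M A (\<lambda>\<omega>. \<mu>)" for A
    using X_mean[of "Suc n"] by (auto simp: has_cond_exp_def)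
  have Suc_ge_1: "1 \<le> Suc n" by simp
  show "subalgebra M (F n)" by (rule subalgebra_F)
  show "(\<lambda>\<omega>. X (Suc n) \<omega> - \<mu>) \<in> borel_measurable M" using X_measurable[of "Suc n"] by measurable
  show "AE \<omega> in M. norm (X (Suc n) \<omega> - \<mu>) \<le> 1"
    using X_bounded[OF Suc_ge_1]
  proof eventually_elim
    case (elim \<omega>)
    then show ?case using norm_triangle_ineq4[of "X (Suc n) \<omega>" \<mu>] norm_mean_le by simp
  qed
  show "(\<integral>\<omega>. indicator A \<omega> *\<^sub>R (X (Suc n) \<omega> - \<mu>) \<partial>M) = 0" if A: "A \<in> sets (F n)" for A
  proof -
    have AM: "A \<in> sets M" using A subalgebra_F[of n] by (auto simp: subalgebra_def)
    have "set_lebesgue_integral M A (\<lambda>\<omega>. X (Suc n) \<omega> - \<mu>)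
        = set_lebesgue_integral M A (X (Suc n)) - set_lebesgue_integral M A (\<lambda>\<omega>. \<mu>)"
      by (intro set_integral_diff)
         (auto simp: set_integrable_def intro!: integrable_mult_indicator AM ce(1))
    then show ?thesis using ce(2)[OF A] by (simp add: set_lebesgue_integral_def)
  qed
  show "AE \<omega> in M. real_cond_exp M (F n) (\<lambda>\<omega>. (norm (X (Suc n) \<omega> - \<mu>))\<^sup>2) \<omega> = v"
    using X_variance[of "Suc n"] by simp
qed

lemma weighted_sum_measurable:
  assumes "predictable F lt"
  shows "(\<lambda>\<omega>. \<Sum>i=1..n. lt i \<omega> *\<^sub>R (X i \<omega> - \<mu>)) \<in> borel_measurable (F n)"
    "(\<lambda>\<omega>. \<Sum>i=1..n. psiP (lt i \<omega>)) \<in> borel_measurable (F n)"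
    "(\<lambda>\<omega>. \<Sum>i=1..Suc n. psiP (lt i \<omega>)) \<in> borel_measurable (F n)"
proof -
  note [measurable (raw)] = canonical_filtration_adapted predictable_measurable[OF assms]
  show "(\<lambda>\<omega>. \<Sum>i=1..n. lt i \<omega> *\<^sub>R (X i \<omega> - \<mu>)) \<in> borel_measurable (F n)"
    "(\<lambda>\<omega>. \<Sum>i=1..n. psiP (lt i \<omega>)) \<in> borel_measurable (F n)"
    "(\<lambda>\<omega>. \<Sum>i=1..Suc n. psiP (lt i \<omega>)) \<in> borel_measurable (F n)"
    by measurable
qed

text \<open>
  Ville's inequality in logarithmic form: T stays below \<open>ln (1 / \<delta>)\<close> at all times, up to probability \<open>\<delta>\<close>, if a
  supermartingale started at 1 dominates \<open>exp T\<close>.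
\<close>

lemma ville_exceedance:
  fixes W :: "nat \<Rightarrow> 'w \<Rightarrow> real" and T :: "nat \<Rightarrow> 'w \<Rightarrow> real"
  assumes "\<And>n. W n \<in> borel_measurable (F n)" and init: "\<And>\<omega>. W 0 \<omega> = 1"
    and "\<And>n A. A \<in> sets (F n) \<Longrightarrow>
      (\<integral>\<^sup>+\<omega>. ennreal (W (Suc n) \<omega>) * indicator A \<omega> \<partial>M) \<le> (\<integral>\<^sup>+\<omega>. ennreal (W n \<omega>) * indicator A \<omega> \<partial>M)"
    and \<delta>: "0 < \<delta>"
    and T: "\<And>n \<omega>. exp (T n \<omega>) \<le> W n \<omega>"
  shows "prob {\<omega> \<in> space M. \<exists>n. ln (1 / \<delta>) \<le> T n \<omega>} \<le> \<delta>"
proof -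
  have W [measurable]: "W n \<in> borel_measurable M" for n
    by (rule F_measurable_M) (rule assms(1))
  have "1 / \<delta> \<le> W n \<omega>" if "ln (1 / \<delta>) \<le> T n \<omega>" for n \<omega>
    using T[of n \<omega>] exp_le_cancel_iff[THEN iffD2, OF that] \<delta> by simp
  then have "prob {\<omega> \<in> space M. \<exists>n. ln (1 / \<delta>) \<le> T n \<omega>} \<le> prob {\<omega> \<in> space M. \<exists>n. 1 / \<delta> \<le> W n \<omega>}"
    by (intro finite_measure_mono) (blast, measurable)
  also have "\<dots> \<le> 1 / (1 / \<delta>)"
  proof (rule ville_inequality[where F = F])
    show "sets (F n) \<subseteq> sets (F (Suc n))" for n
      by (intro sets_canonical_filtration_mono) simp
    show "(\<integral>\<^sup>+\<omega>. ennreal (W 0 \<omega>) \<partial>M) \<le> 1" by (simp add: init emeasure_space_1)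
  qed (use assms subalgebra_F in auto)
  finally show ?thesis by simp
qed

text \<open>
  With \<open>S n\<close> the weighted sum of the centred observations, the process
  \<open>cosh (norm (S n)) * exp (- v * (\<Sum>i\<le>n. psiP (lt i)))\<close> is a supermartingale: by the pointwise inequality for
  cosh, the conditional expectation of \<open>cosh (norm (S (n + 1)))\<close> is at most
  \<open>cosh (norm (S n)) * (1 + v * psiP (lt (n + 1)))\<close>, and \<open>1 + x \<le> exp x\<close>. The summand \<open>ln 2\<close> is the price of
  \<open>exp y \<le> 2 * cosh y\<close>.
\<close>

lemma pinelis_bound:
  assumes lt: "predictable F lt" and lt0: "\<And>i. 1 \<le> i \<Longrightarrow> AE \<omega> in M. 0 \<le> lt i \<omega>" and \<delta>: "0 < \<delta>"
  shows "prob {\<omega> \<in> space M. \<exists>n. ln (1 / \<delta>) \<le>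
    norm (\<Sum>i=1..n. lt i \<omega> *\<^sub>R (X i \<omega> - \<mu>)) - v * (\<Sum>i=1..n. psiP (lt i \<omega>)) - ln 2} \<le> \<delta>"
proof -
  define S where "S n \<omega> = (\<Sum>i=1..n. lt i \<omega> *\<^sub>R (X i \<omega> - \<mu>))" for n \<omega>
  define \<Psi> where "\<Psi> n \<omega> = (\<Sum>i=1..n. psiP (lt i \<omega>))" for n \<omega>
  define W where "W n \<omega> = exp (- (v * \<Psi> n \<omega>)) * cosh (norm (S n \<omega>))" for n \<omega>
  have SF [measurable]: "S n \<in> borel_measurable (F n)" and \<Psi>F [measurable]: "\<Psi> n \<in> borel_measurable (F n)"
    and \<Psi>F' [measurable]: "\<Psi> (Suc n) \<in> borel_measurable (F n)" for n
    unfolding S_def[abs_def] \<Psi>_def[abs_def] by (rule weighted_sum_measurable[OF lt])+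
  have ltF [measurable]: "lt (Suc n) \<in> borel_measurable (F n)" for n
    by (rule predictable_measurable[OF lt]) auto
  have WF [measurable]: "W n \<in> borel_measurable (F n)" for n
    unfolding W_def by measurable
  have step: "(\<integral>\<^sup>+\<omega>. ennreal (W (Suc n) \<omega>) * indicator A \<omega> \<partial>M) \<le> (\<integral>\<^sup>+\<omega>. ennreal (W n \<omega>) * indicator A \<omega> \<partial>M)"
    if A: "A \<in> sets (F n)" for n A
  proof -
    interpret Z: centred_variable M "F n" "\<lambda>\<omega>. X (Suc n) \<omega> - \<mu>" v by (rule centred_variable_X)
    have Suc_ge_1: "1 \<le> Suc n" by simp
    \<comment> \<open>The compensator at time n + 1 is already known at time n, because the weights are predictable.\<close>
    define E where "E \<omega> = exp (- (v * \<Psi> (Suc n) \<omega>))" for \<omega>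
    define a where "a \<omega> = norm (S n \<omega>)" for \<omega>
    have [measurable]: "E \<in> borel_measurable (F n)" "a \<in> borel_measurable (F n)"
      unfolding E_def a_def by measurable
    show ?thesis
    proof (rule Z.quadratic_conditional_bound[where
          P = "\<lambda>\<omega>. E \<omega> * cosh (a \<omega>)" and
          Q = "\<lambda>\<omega>. E \<omega> * (cosh (a \<omega>) * psiP (lt (Suc n) \<omega>))" and
          V = "\<lambda>\<omega>. (E \<omega> * (sinh (a \<omega>) / a \<omega>) * lt (Suc n) \<omega>) *\<^sub>R S n \<omega>", OF _ _ _ _ _ WF _ _ _ A])
      show "W (Suc n) \<in> borel_measurable M" by (rule F_measurable_M[OF WF])
      show "0 \<le> W (Suc n) \<omega>" "0 \<le> W n \<omega>" for \<omega> by (simp_all add: W_def)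
      show "AE \<omega> in M. W (Suc n) \<omega> \<le> E \<omega> * cosh (a \<omega>)
          + ((E \<omega> * (sinh (a \<omega>) / a \<omega>) * lt (Suc n) \<omega>) *\<^sub>R S n \<omega>) \<bullet> (X (Suc n) \<omega> - \<mu>)
          + (E \<omega> * (cosh (a \<omega>) * psiP (lt (Suc n) \<omega>))) * (norm (X (Suc n) \<omega> - \<mu>))\<^sup>2"
        using Z.Z_bounded lt0[OF Suc_ge_1]
      proof eventually_elim
        case (elim \<omega>)
        define z where "z = X (Suc n) \<omega> - \<mu>"
        have S: "S (Suc n) \<omega> = S n \<omega> + lt (Suc n) \<omega> *\<^sub>R z" by (simp add: S_def z_def)
        have "cosh (norm (S (Suc n) \<omega>)) \<le> cosh (a \<omega>) + (sinh (a \<omega>) / a \<omega>) * (S n \<omega> \<bullet> (lt (Suc n) \<omega> *\<^sub>R z))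
            + cosh (a \<omega>) * psiP (norm (lt (Suc n) \<omega> *\<^sub>R z))"
          unfolding S a_def by (rule cosh_norm_add_le)
        also have "\<dots> \<le> cosh (a \<omega>) + (sinh (a \<omega>) / a \<omega>) * (S n \<omega> \<bullet> (lt (Suc n) \<omega> *\<^sub>R z))
            + cosh (a \<omega>) * ((norm z)\<^sup>2 * psiP (lt (Suc n) \<omega>))"
          using psiP_mult_le[of "lt (Suc n) \<omega>" "norm z"] elim
          by (intro add_left_mono mult_left_mono) (auto simp: z_def)
        finally have "E \<omega> * cosh (norm (S (Suc n) \<omega>)) \<le> E \<omega> * (cosh (a \<omega>) + (sinh (a \<omega>) / a \<omega>) * (S n \<omega> \<bullet> (lt (Suc n) \<omega> *\<^sub>R z))
            + cosh (a \<omega>) * ((norm z)\<^sup>2 * psiP (lt (Suc n) \<omega>)))"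
          by (intro mult_left_mono) (auto simp: E_def)
        then show ?case
          unfolding z_def[symmetric] by (simp add: W_def E_def[symmetric] algebra_simps)
      qed
      show "AE \<omega> in M. E \<omega> * cosh (a \<omega>) + E \<omega> * (cosh (a \<omega>) * psiP (lt (Suc n) \<omega>)) * v \<le> W n \<omega>"
      proof (rule AE_I2)
        fix \<omega>
        have \<Psi>: "\<Psi> (Suc n) \<omega> = \<Psi> n \<omega> + psiP (lt (Suc n) \<omega>)" by (simp add: \<Psi>_def)
        have "1 + v * psiP (lt (Suc n) \<omega>) \<le> exp (v * psiP (lt (Suc n) \<omega>))"
          by (rule exp_ge_add_one_self)
        then have "E \<omega> * cosh (a \<omega>) * (1 + v * psiP (lt (Suc n) \<omega>)) \<le> E \<omega> * cosh (a \<omega>) * exp (v * psiP (lt (Suc n) \<omega>))"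
          by (intro mult_left_mono) (auto simp: E_def)
        also have "\<dots> = cosh (a \<omega>) * (E \<omega> * exp (v * psiP (lt (Suc n) \<omega>)))"
          by (simp only: mult_ac)
        also have "E \<omega> * exp (v * psiP (lt (Suc n) \<omega>)) = exp (- (v * \<Psi> n \<omega>))"
          by (simp add: E_def \<Psi> distrib_left flip: exp_add)
        also have "cosh (a \<omega>) * \<dots> = W n \<omega>"
          by (simp add: W_def a_def mult.commute)
        finally show "E \<omega> * cosh (a \<omega>) + E \<omega> * (cosh (a \<omega>) * psiP (lt (Suc n) \<omega>)) * v \<le> W n \<omega>"
          by (simp add: algebra_simps)
      qed
    qed measurable
  qed
  have "prob {\<omega> \<in> space M. \<exists>n. ln (1 / \<delta>) \<le> norm (S n \<omega>) - v * \<Psi> n \<omega> - ln 2} \<le> \<delta>"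
  proof (rule ville_exceedance[OF WF _ step \<delta>])
    show "W 0 \<omega> = 1" for \<omega> by (simp add: W_def S_def \<Psi>_def)
    show "exp (norm (S n \<omega>) - v * \<Psi> n \<omega> - ln 2) \<le> W n \<omega>" for n \<omega>
    proof -
      have "exp (norm (S n \<omega>)) / 2 \<le> cosh (norm (S n \<omega>))" by (simp add: cosh_field_def)
      then have "exp (- (v * \<Psi> n \<omega>)) * (exp (norm (S n \<omega>)) / 2) \<le> W n \<omega>"
        unfolding W_def by (intro mult_left_mono) auto
      moreover have "exp (norm (S n \<omega>) - v * \<Psi> n \<omega> - ln 2) = exp (- (v * \<Psi> n \<omega>)) * (exp (norm (S n \<omega>)) / 2)"
        by (simp add: exp_diff exp_add exp_minus field_simps)
      ultimately show ?thesis by simp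
    qed
  qed
  then show ?thesis unfolding S_def \<Psi>_def .
qed

text \<open>
  The exponential of the sum is a supermartingale. If \<open>\<xi>\<close> is the difference of the squared residual and its
  prediction s2, then \<open>\<xi> \<ge> -1\<close>, and Fan's inequality bounds the new factor by
  \<open>1 + l * \<xi>\<close> times a predictable factor. This is quadratic in the centred observation, and the conditional
  expectation of the squared residual is \<open>v + (norm (m - \<mu>))\<^sup>2\<close> for a predictable centre m.
\<close>

lemma empirical_bernstein_bound:
  fixes m :: "nat \<Rightarrow> 'w \<Rightarrow> 'h"
  assumes l: "predictable F l" and l01: "\<And>i. 1 \<le> i \<Longrightarrow> AE \<omega> in M. 0 \<le> l i \<omega> \<and> l i \<omega> < 1"
    and s2: "predictable F s2" and s2le: "\<And>i. 1 \<le> i \<Longrightarrow> AE \<omega> in M. s2 i \<omega> \<le> 1"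
    and m: "\<And>i t. 1 \<le> i \<Longrightarrow> i \<le> Suc t \<Longrightarrow> m i \<in> borel_measurable (F t)"
    and \<delta>: "0 < \<delta>"
  shows "prob {\<omega> \<in> space M. \<exists>n. ln (1 / \<delta>) \<le>
    (\<Sum>i=1..n. l i \<omega> * ((norm (X i \<omega> - m i \<omega>))\<^sup>2 - (v + (norm (m i \<omega> - \<mu>))\<^sup>2))
        - psiE (l i \<omega>) * ((norm (X i \<omega> - m i \<omega>))\<^sup>2 - s2 i \<omega>)\<^sup>2)} \<le> \<delta>"
proof -
  define T where "T n \<omega> = (\<Sum>i=1..n. l i \<omega> * ((norm (X i \<omega> - m i \<omega>))\<^sup>2 - (v + (norm (m i \<omega> - \<mu>))\<^sup>2))
        - psiE (l i \<omega>) * ((norm (X i \<omega> - m i \<omega>))\<^sup>2 - s2 i \<omega>)\<^sup>2)" for n \<omega>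
  have TF: "T n \<in> borel_measurable (F n)" for n
  proof -
    note [measurable (raw)] = canonical_filtration_adapted predictable_measurable[OF l] predictable_measurable[OF s2] m
    show ?thesis unfolding T_def by measurable
  qed
  have WF [measurable]: "(\<lambda>\<omega>. exp (T n \<omega>)) \<in> borel_measurable (F n)" for n
    using TF by measurable
  have step: "(\<integral>\<^sup>+\<omega>. ennreal (exp (T (Suc n) \<omega>)) * indicator A \<omega> \<partial>M) \<le> (\<integral>\<^sup>+\<omega>. ennreal (exp (T n \<omega>)) * indicator A \<omega> \<partial>M)"
    if A: "A \<in> sets (F n)" for n A
  proof -
    interpret Z: centred_variable M "F n" "\<lambda>\<omega>. X (Suc n) \<omega> - \<mu>" v by (rule centred_variable_X)
    have Suc_ge_1: "1 \<le> Suc n" by simp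
    have [measurable]: "l (Suc n) \<in> borel_measurable (F n)" "s2 (Suc n) \<in> borel_measurable (F n)"
        "m (Suc n) \<in> borel_measurable (F n)"
      by (auto intro: predictable_measurable l s2 m)
    define c where "c \<omega> = (norm (m (Suc n) \<omega> - \<mu>))\<^sup>2 - s2 (Suc n) \<omega>" for \<omega>
    \<comment> \<open>E collects the known factors once the exponent of step n + 1 has been rewritten in terms of \<xi>.\<close>
    define E where "E \<omega> = exp (T n \<omega> - l (Suc n) \<omega> * (c \<omega> + v))" for \<omega>
    have [measurable]: "c \<in> borel_measurable (F n)"
      unfolding c_def by measurable
    have [measurable]: "E \<in> borel_measurable (F n)"
      unfolding E_def using TF by measurable
    show ?thesis
    proof (rule Z.quadratic_conditional_bound[where
          P = "\<lambda>\<omega>. E \<omega> * (1 + l (Suc n) \<omega> * c \<omega>)" and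
          Q = "\<lambda>\<omega>. E \<omega> * l (Suc n) \<omega>" and
          V = "\<lambda>\<omega>. (- 2 * (E \<omega> * l (Suc n) \<omega>)) *\<^sub>R (m (Suc n) \<omega> - \<mu>)", OF _ _ _ _ _ WF _ _ _ A])
      show "(\<lambda>\<omega>. exp (T (Suc n) \<omega>)) \<in> borel_measurable M" by (rule F_measurable_M[OF WF])
      show "0 \<le> exp (T (Suc n) \<omega>)" "0 \<le> exp (T n \<omega>)" for \<omega> by simp_all
      show "AE \<omega> in M. exp (T (Suc n) \<omega>) \<le> E \<omega> * (1 + l (Suc n) \<omega> * c \<omega>)
          + ((- 2 * (E \<omega> * l (Suc n) \<omega>)) *\<^sub>R (m (Suc n) \<omega> - \<mu>)) \<bullet> (X (Suc n) \<omega> - \<mu>)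
          + (E \<omega> * l (Suc n) \<omega>) * (norm (X (Suc n) \<omega> - \<mu>))\<^sup>2"
        using l01[OF Suc_ge_1] s2le[OF Suc_ge_1]
      proof eventually_elim
        case (elim \<omega>)
        define z p q where "z = X (Suc n) \<omega> - \<mu>" and "p = m (Suc n) \<omega> - \<mu>" and "q = l (Suc n) \<omega>"
        define \<xi> where "\<xi> = (norm (X (Suc n) \<omega> - m (Suc n) \<omega>))\<^sup>2 - s2 (Suc n) \<omega>"
        have "X (Suc n) \<omega> - m (Suc n) \<omega> = z - p" by (simp add: z_def p_def)
        then have sq: "(norm (X (Suc n) \<omega> - m (Suc n) \<omega>))\<^sup>2 = (norm z)\<^sup>2 - 2 * (p \<bullet> z) + (norm p)\<^sup>2"
          by (simp add: power2_norm_eq_inner inner_diff_left inner_diff_right inner_commute)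
        then have \<xi>: "\<xi> = c \<omega> - 2 * (p \<bullet> z) + (norm z)\<^sup>2"
          by (simp add: \<xi>_def c_def p_def)
        have "-1 \<le> \<xi>"
          unfolding \<xi>_def using elim(2) zero_le_power2[of "norm (X (Suc n) \<omega> - m (Suc n) \<omega>)"] by linarith
        with elim(1) have "exp (q * \<xi> - psiE q * \<xi>\<^sup>2) \<le> 1 + q * \<xi>"
          unfolding q_def by (intro exp_psiE_le) auto
        then have "E \<omega> * exp (q * \<xi> - psiE q * \<xi>\<^sup>2) \<le> E \<omega> * (1 + q * \<xi>)"
          by (intro mult_left_mono) (auto simp: E_def)
        moreover have "T (Suc n) \<omega> = T n \<omega> - q * (c \<omega> + v) + (q * \<xi> - psiE q * \<xi>\<^sup>2)"
          by (simp add: T_def \<xi>_def c_def q_def algebra_simps)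
        then have "exp (T (Suc n) \<omega>) = E \<omega> * exp (q * \<xi> - psiE q * \<xi>\<^sup>2)"
          by (simp only: E_def q_def exp_add)
        ultimately show ?case
          unfolding z_def[symmetric] p_def[symmetric] q_def[symmetric] by (simp add: \<xi> algebra_simps)
      qed
      show "AE \<omega> in M. E \<omega> * (1 + l (Suc n) \<omega> * c \<omega>) + E \<omega> * l (Suc n) \<omega> * v \<le> exp (T n \<omega>)"
      proof (rule AE_I2)
        fix \<omega>
        have "E \<omega> * (1 + l (Suc n) \<omega> * (c \<omega> + v)) \<le> E \<omega> * exp (l (Suc n) \<omega> * (c \<omega> + v))"
          by (intro mult_left_mono exp_ge_add_one_self) (simp add: E_def)
        also have "\<dots> = exp (T n \<omega>)"
          by (simp add: E_def exp_diff)
        finally show "E \<omega> * (1 + l (Suc n) \<omega> * c \<omega>) + E \<omega> * l (Suc n) \<omega> * v \<le> exp (T n \<omega>)"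
          by (simp add: algebra_simps)
      qed
    qed measurable
  qed
  have "prob {\<omega> \<in> space M. \<exists>n. ln (1 / \<delta>) \<le> T n \<omega>} \<le> \<delta>"
    by (rule ville_exceedance[OF WF _ step \<delta>]) (auto simp: T_def)
  then show ?thesis unfolding T_def .
qed

end

section \<open>The confidence sequence\<close>

theorem corollaryA6:
  fixes M :: "'w measure"
    and X :: "nat \<Rightarrow> 'w \<Rightarrow> 'h::{real_inner, banach, second_countable_topology}"
    and \<mu> :: 'h
    and \<sigma> \<alpha> \<alpha>1 \<alpha>2 :: real
    and s2 l lt :: "nat \<Rightarrow> 'w \<Rightarrow> real"
  defines "F \<equiv> canonical_filtration M X"
  assumes "prob_space M"
    and "\<And>t. t \<ge> 1 \<Longrightarrow> X t \<in> borel_measurable M"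
    and "\<And>t. t \<ge> 1 \<Longrightarrow> AE \<omega> in M. norm (X t \<omega>) \<in> {0..1/2}"
    and "\<And>t. t \<ge> 1 \<Longrightarrow> has_cond_exp M (F (t - 1)) (X t) (\<lambda>\<omega>. \<mu>)"
    and "\<And>t. t \<ge> 1 \<Longrightarrow>
           AE \<omega> in M. real_cond_exp M (F (t - 1)) (\<lambda>\<omega>. (norm (X t \<omega> - \<mu>))\<^sup>2) \<omega> = \<sigma>\<^sup>2"
    and "\<alpha> \<in> {0<..<1}" and "\<alpha>1 > 0" and "\<alpha>2 > 0" and "\<alpha>1 + \<alpha>2 = \<alpha>"
    and "predictable F s2" and "\<And>i. i \<ge> 1 \<Longrightarrow> AE \<omega> in M. s2 i \<omega> \<in> {0..1}"
    and "predictable F l" and "\<And>i. i \<ge> 1 \<Longrightarrow> AE \<omega> in M. l i \<omega> \<in> {0..<1}"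
    and "predictable F lt" and "\<And>i. i \<ge> 1 \<Longrightarrow> AE \<omega> in M. lt i \<omega> \<in> {0..}"
  shows "confidence_sequence M (1 - \<alpha>) (\<sigma>\<^sup>2)
           (\<lambda>t \<omega>. {v::real. L_hs \<alpha>1 \<alpha>2 (\<lambda>i. l i \<omega>) (\<lambda>i. lt i \<omega>) (\<lambda>i. s2 i \<omega>) (\<lambda>i. X i \<omega>) t < ereal v})"
proof -
  interpret prob_space M by (rule assms(2))
  interpret constant_mean_variance M X \<mu> "\<sigma>\<^sup>2"
  proof unfold_locales
    show "AE \<omega> in M. norm (X t \<omega>) \<le> 1 / 2" if "1 \<le> t" for t
      using assms(4)[OF that] by eventually_elim simp
  qed (use assms(3,5,6) in \<open>simp_all add: F_def\<close>)
  note s2 = assms(11)[unfolded F_def] and l = assms(13)[unfolded F_def] and lt = assms(15)[unfolded F_def]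
  have \<alpha>: "0 < \<alpha>1" "0 < \<alpha>2" "\<alpha>1 \<le> 2" using assms(7-10) by auto
  let ?m = "\<lambda>i \<omega>. mu_hs (\<lambda>j. lt j \<omega>) (\<lambda>j. X j \<omega>) i"
  have mF: "?m i \<in> borel_measurable (canonical_filtration M X t)" if "1 \<le> i" "i \<le> Suc t" for i t
    by (rule mu_hs_measurable) (use that in \<open>auto intro: predictable_measurable[OF lt] canonical_filtration_adapted\<close>)
  \<comment> \<open>On the event that T1 and T2 both stay below their thresholds the bound holds on every path with
    admissible weights; the two exceptional events have total probability at most \<alpha>.\<close>
  define T1 where "T1 n \<omega> = norm (\<Sum>i=1..n. lt i \<omega> *\<^sub>R (X i \<omega> - \<mu>)) - \<sigma>\<^sup>2 * (\<Sum>i=1..n. psiP (lt i \<omega>)) - ln 2" for n \<omega>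
  define T2 where "T2 n \<omega> = (\<Sum>i=1..n. l i \<omega> * ((norm (X i \<omega> - ?m i \<omega>))\<^sup>2 - (\<sigma>\<^sup>2 + (norm (?m i \<omega> - \<mu>))\<^sup>2))
        - psiE (l i \<omega>) * ((norm (X i \<omega> - ?m i \<omega>))\<^sup>2 - s2 i \<omega>)\<^sup>2)" for n \<omega>
  let ?B1 = "{\<omega> \<in> space M. \<exists>n. ln (1 / \<alpha>1) \<le> T1 n \<omega>}"
    and ?B2 = "{\<omega> \<in> space M. \<exists>n. ln (1 / \<alpha>2) \<le> T2 n \<omega>}"
  have "prob ?B1 \<le> \<alpha>1"
    unfolding T1_def by (rule pinelis_bound[OF lt _ \<alpha>(1)]) (use assms(16) in simp)
  moreover have "prob ?B2 \<le> \<alpha>2"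
    unfolding T2_def
    by (rule empirical_bernstein_bound[OF l _ s2 _ mF \<alpha>(2)]) (use assms(12,14) in \<open>auto elim!: eventually_mono\<close>)
  moreover note M_measurable = predictable_measurable[THEN F_measurable_M]
  have [measurable (raw)]: "lt i \<in> borel_measurable M" "l i \<in> borel_measurable M" "s2 i \<in> borel_measurable M"
      "X i \<in> borel_measurable M" "?m i \<in> borel_measurable M" if "1 \<le> i" for i
    using that X_measurable M_measurable[OF lt that le_SucI, OF order.refl] M_measurable[OF l that le_SucI, OF order.refl]
      M_measurable[OF s2 that le_SucI, OF order.refl] F_measurable_M[OF mF[OF that le_SucI, OF order.refl]] by auto
  have [measurable]: "T1 n \<in> borel_measurable M" "T2 n \<in> borel_measurable M" for n
    unfolding T1_def[abs_def] T2_def[abs_def] by measurable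
  have B_sets: "?B1 \<in> events" "?B2 \<in> events" by measurable
  ultimately have "prob (?B1 \<union> ?B2) \<le> \<alpha>"
    using measure_Un_le[OF B_sets] assms(10) by linarith
  then have "1 - \<alpha> \<le> prob (space M - (?B1 \<union> ?B2))"
    using B_sets by (subst prob_compl) auto
  also have "\<dots> \<le> prob {\<omega> \<in> space M. \<forall>t\<ge>1. L_hs \<alpha>1 \<alpha>2 (\<lambda>i. l i \<omega>) (\<lambda>i. lt i \<omega>) (\<lambda>i. s2 i \<omega>) (\<lambda>i. X i \<omega>) t < ereal (\<sigma>\<^sup>2)}"
  proof (rule finite_measure_mono_AE)
    have "(\<lambda>\<omega>. L_hs \<alpha>1 \<alpha>2 (\<lambda>i. l i \<omega>) (\<lambda>i. lt i \<omega>) (\<lambda>i. s2 i \<omega>) (\<lambda>i. X i \<omega>) t) \<in> borel_measurable M" for t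
      by (rule L_hs_measurable) measurable
    then show "{\<omega> \<in> space M. \<forall>t\<ge>1. L_hs \<alpha>1 \<alpha>2 (\<lambda>i. l i \<omega>) (\<lambda>i. lt i \<omega>) (\<lambda>i. s2 i \<omega>) (\<lambda>i. X i \<omega>) t < ereal (\<sigma>\<^sup>2)} \<in> events"
      by measurable
    have "AE \<omega> in M. \<forall>i. 1 \<le> i \<longrightarrow> 0 \<le> l i \<omega> \<and> 0 \<le> lt i \<omega>"
      unfolding AE_all_countable
    proof (intro allI)
      fix i :: nat
      show "AE \<omega> in M. 1 \<le> i \<longrightarrow> 0 \<le> l i \<omega> \<and> 0 \<le> lt i \<omega>"
      proof (cases "1 \<le> i")
        case True
        show ?thesis using assms(14)[OF True] assms(16)[OF True] by eventually_elim simp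
      qed simp
    qed
    then show "AE \<omega> in M. \<omega> \<in> space M - (?B1 \<union> ?B2) \<longrightarrow> \<omega> \<in> {\<omega> \<in> space M. \<forall>t\<ge>1.
        L_hs \<alpha>1 \<alpha>2 (\<lambda>i. l i \<omega>) (\<lambda>i. lt i \<omega>) (\<lambda>i. s2 i \<omega>) (\<lambda>i. X i \<omega>) t < ereal (\<sigma>\<^sup>2)}"
    proof eventually_elim
      case (elim \<omega>)
      show ?case
      proof (intro impI CollectI conjI allI)
        assume good: "\<omega> \<in> space M - (?B1 \<union> ?B2)"
        then show "\<omega> \<in> space M" by blast
        fix t :: nat
        have T1: "T1 n \<omega> < ln (1 / \<alpha>1)" and T2: "T2 n \<omega> < ln (1 / \<alpha>2)" for n
          using good by (auto simp: not_le)
        have "ln (2 / \<alpha>1) = ln (1 / \<alpha>1) + ln 2"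
          using \<alpha> by (simp add: ln_div)
        then have dev: "norm (\<Sum>i=1..n. lt i \<omega> *\<^sub>R (X i \<omega> - \<mu>)) \<le> ln (2 / \<alpha>1) + \<sigma>\<^sup>2 * (\<Sum>i=1..n. psiP (lt i \<omega>))" for n
          using T1[of n] unfolding T1_def by linarith
        show "L_hs \<alpha>1 \<alpha>2 (\<lambda>i. l i \<omega>) (\<lambda>i. lt i \<omega>) (\<lambda>i. s2 i \<omega>) (\<lambda>i. X i \<omega>) t < ereal (\<sigma>\<^sup>2)"
          by (rule L_hs_less[OF _ _ norm_mean_le _ \<alpha>(1,3) dev])
             (use elim T2[of t] in \<open>auto simp: T2_def\<close>)
      qed
    qed
  qed
  finally show ?thesis unfolding confidence_sequence_def by simp
qed

end
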